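(* Let $\gamma^*:[0,1]\to\mathbb{R}^n$ be a computable function (not necessarily one-to-one) such that $\Gamma=\gamma^*([0,1])$ is a simple rectifiable curve. Let $l=\mathcal{H}^1(\Gamma)$, let $O_l$ be any oracle for $l$, i.e. $O_l:\mathbb{N}\to\mathbb{Q}$ with $|O_l(n)-l|\le2^{-n}$ for all $n\in\mathbb{N}$, and let $\gamma$ be a normalized constant-speed parametrization of $\Gamma$. Then $\gamma$ is computable with oracle $O_l$.
   Context: A curve is simple if it is the range of a one-to-one continuous map from a compact interval, and rectifiable if it has finite length; $\mathcal{H}^1$ is one-dimensional Hausdorff measure (equal to length for simple curves). A normalized constant-speed parametrization of a simple rectifiable curve $\Gamma$ of length $L$ is a one-to-one continuous $\gamma:[0,1]\to\mathbb{R}^n$ with range $\Gamma$ such that $\gamma([0,t])$ has length $tL$ for all $0\le t\le1$ (there are exactly two, one in each direction). An oracle for a real $t$ is any $O_t:\mathbb{N}\to\mathbb{Q}$ with $|O_t(s)-t|\le2^{-s}$ for all $s$. A function $f:[0,1]\to\mathbb{R}^n$ is computable if there is an oracle Turing machine $M$ such that for every $t\in[0,1]$, $r\in\mathbb{N}$, and every oracle $O_t$ for $t$, $M^{O_t}(r)$ outputs a rational point within $2^{-r}$ of $f(t)$; it is computable with oracle $O_l$ if the same holds for a machine that additionally has access to $O_l$. *)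

theory Defs
  imports "HOL-Analysis.Analysis" "HOL-Library.Nat_Bijection"
begin

definition hausdorff1_pre :: "real \<Rightarrow> 'a::metric_space set \<Rightarrow> ennreal" where
  "hausdorff1_pre \<delta> A =
     (INF C \<in> {C :: nat \<Rightarrow> 'a set. A \<subseteq> (\<Union>i. C i) \<and> (\<forall>i. bounded (C i) \<and> diameter (C i) \<le> \<delta>)}.
        (\<Sum>i. ennreal (diameter (C i))))"

text \<open>H^1(A) = lim_{delta -> 0+} H^1_delta(A) (a supremum, since H^1_delta decreases in delta).\<close>
definition hausdorff1 :: "'a::metric_space set \<Rightarrow> ennreal" where
  "hausdorff1 A = (SUP \<delta> \<in> {0<..}. hausdorff1_pre \<delta> A)"

definition simple_curve :: "'a::metric_space set \<Rightarrow> bool" where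
  "simple_curve \<Gamma> \<longleftrightarrow>
     (\<exists>(g :: real \<Rightarrow> 'a) a b. a \<le> b \<and> continuous_on {a..b} g \<and> inj_on g {a..b} \<and> g ` {a..b} = \<Gamma>)"

definition rectifiable_curve :: "'a::metric_space set \<Rightarrow> bool" where
  "rectifiable_curve \<Gamma> \<longleftrightarrow> hausdorff1 \<Gamma> < \<infinity>"

definition normalized_constant_speed_param ::
    "(real \<Rightarrow> 'a::metric_space) \<Rightarrow> 'a set \<Rightarrow> bool" where
  "normalized_constant_speed_param \<gamma> \<Gamma> \<longleftrightarrow>
     continuous_on {0..1} \<gamma> \<and> inj_on \<gamma> {0..1} \<and> \<gamma> ` {0..1} = \<Gamma> \<and>
     (\<forall>t \<in> {0..1}. hausdorff1 (\<gamma> ` {0..t}) = ennreal t * hausdorff1 \<Gamma>)"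

definition is_oracle :: "(nat \<Rightarrow> rat) \<Rightarrow> real \<Rightarrow> bool" where
  "is_oracle Ot t \<longleftrightarrow> (\<forall>s. \<bar>real_of_rat (Ot s) - t\<bar> \<le> 2 powr (- real s))"

definition rat_of_code :: "nat \<Rightarrow> rat" where
  "rat_of_code k = (case prod_decode k of (a, b) \<Rightarrow> of_int (int_decode a) / of_nat (Suc b))"

definition coord_enum :: "'n::finite list" where
  "coord_enum = (SOME xs. distinct xs \<and> set xs = UNIV)"

definition point_of_code :: "nat \<Rightarrow> real ^ 'n::finite" where
  "point_of_code c =
     (\<chi> i. case map_of (zip (coord_enum :: 'n list) (list_decode c)) i of
             None \<Rightarrow> 0 | Some k \<Rightarrow> real_of_rat (rat_of_code k))"

datatype recf =
    Zr
  | Sc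
  | Pj nat
  | Cn recf "recf list"
  | Pr recf recf
  | Mn recf
  | Orc nat

inductive reval :: "(nat \<Rightarrow> nat) list \<Rightarrow> recf \<Rightarrow> nat list \<Rightarrow> nat \<Rightarrow> bool"
  for os :: "(nat \<Rightarrow> nat) list" where
  zero: "reval os Zr xs 0"
| succ: "reval os Sc (x # xs) (Suc x)"
| proj: "i < length xs \<Longrightarrow> reval os (Pj i) xs (xs ! i)"
| comp: "list_all2 (\<lambda>g y. reval os g xs y) gs ys \<Longrightarrow> reval os f ys z \<Longrightarrow> reval os (Cn f gs) xs z"
| prim0: "reval os f xs y \<Longrightarrow> reval os (Pr f g) (0 # xs) y"
| primS: "reval os (Pr f g) (n # xs) y \<Longrightarrow> reval os g (n # y # xs) z \<Longrightarrow>
          reval os (Pr f g) (Suc n # xs) z"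
| mu: "reval os f (n # xs) 0 \<Longrightarrow> (\<forall>m < n. \<exists>y. y \<noteq> 0 \<and> reval os f (m # xs) y) \<Longrightarrow>
       reval os (Mn f) xs n"
| orc: "k < length os \<Longrightarrow> reval os (Orc k) (x # xs) ((os ! k) x)"

text \<open>The machine reads an oracle as a nat-valued function whose values code rationals;
  it must work for every such coding of every oracle for the input.\<close>
definition codes_oracle :: "(nat \<Rightarrow> nat) \<Rightarrow> (nat \<Rightarrow> rat) \<Rightarrow> bool" where
  "codes_oracle g Ot \<longleftrightarrow> (\<forall>s. rat_of_code (g s) = Ot s)"

definition computable_fun :: "(real \<Rightarrow> real ^ 'n::finite) \<Rightarrow> bool" where
  "computable_fun f \<longleftrightarrow>
     (\<exists>M. \<forall>t \<in> {0..1}. \<forall>Ot. is_oracle Ot t \<longrightarrow> (\<forall>g. codes_oracle g Ot \<longrightarrow>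
        (\<forall>r. \<exists>c. reval [g] M [r] c \<and> dist (point_of_code c :: real ^ 'n) (f t) \<le> 2 powr (- real r))))"

definition computable_fun_with_oracle :: "(nat \<Rightarrow> rat) \<Rightarrow> (real \<Rightarrow> real ^ 'n::finite) \<Rightarrow> bool" where
  "computable_fun_with_oracle Ol f \<longleftrightarrow>
     (\<exists>M. \<forall>t \<in> {0..1}. \<forall>Ot. is_oracle Ot t \<longrightarrow> (\<forall>g. codes_oracle g Ot \<longrightarrow>
        (\<forall>h. codes_oracle h Ol \<longrightarrow>
        (\<forall>r. \<exists>c. reval [g, h] M [r] c \<and> dist (point_of_code c :: real ^ 'n) (f t) \<le> 2 powr (- real r)))))"

end

theory Submission
  imports Defs "HOL-Complex_Analysis.Great_Picard"
begin

text \<open>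
  The parametrization \<open>\<gamma>\<close> is \<open>l\<close>-Lipschitz, and it is rigid: an \<open>l\<close>-Lipschitz path on \<open>[0,1]\<close> whose range
  covers \<open>\<Gamma>\<close> has no length to spare, so it stays in \<open>\<Gamma>\<close>, and \<open>\<gamma>\<inverse>\<close> composed with it is a 1-Lipschitz
  map of \<open>[0,1]\<close> onto itself; hence it is \<open>\<gamma>\<close> or its reversal. Consider the polygons with \<open>2\<^sup>n\<close> edges and
  vertices in a fine grid whose edges have length at most about \<open>l / 2\<^sup>n\<close>, which pass close to the sample
  points \<open>\<gamma>\<^sup>*(j / 2\<^sup>n)\<close>, and which run in the direction of \<open>\<gamma>\<close>. Rounding \<open>\<gamma>\<close> gives one of them, and by
  Arzela-Ascoli and rigidity all of them are uniformly close to \<open>\<gamma>\<close> once \<open>n\<close> is large. So an algorithm may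
  search for an \<open>n\<close> at which all these (finitely many) polygons nearly agree at the vertex closest to the
  time \<open>t\<close>, and output that vertex. No modulus of continuity of \<open>\<gamma>\<^sup>*\<close> and no a priori rate are needed.
\<close>

subsection \<open>One-dimensional Hausdorff measure\<close>

text \<open>Correctness and termination rest on different facts. The rounding of \<gamma> is
  feasible at every stage, so a vertex on which all feasible polygons agree is near \<gamma>
  whenever the search stops; compactness only shows that it does stop. The length oracle enters
  through the edge bound, which must tend to exactly \<open>l\<close> for rigidity to apply to a
  limit path. Edges span a time of \<open>2^-n\<close> while the grid has mesh \<open>4^-n\<close>,
  so rounding changes the speed only by a multiple of \<open>2^-n\<close> and the bound keeps its
  limit. Feasibility is decidable because all its data are natural numbers: a dyadic time has an
  exact constant oracle, so the machine for \<open>\<gamma>star\<close> can be run on it as a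
  numerical function. Closeness is demanded only at dyadic samples; these are dense in \<Gamma>
  because a halting computation reads finitely many oracle values. The direction and the bounds
  \<open>R\<close> and \<open>K\<close> are finitely many numbers built into the program.\<close>

lemma hausdorff1_pre_mono: "A \<subseteq> B \<Longrightarrow> hausdorff1_pre \<delta> A \<le> hausdorff1_pre \<delta> B"
  unfolding hausdorff1_pre_def by (rule INF_superset_mono) auto

lemma hausdorff1_pre_antimono: "\<delta> \<le> \<delta>' \<Longrightarrow> hausdorff1_pre \<delta>' A \<le> hausdorff1_pre \<delta> A"
  unfolding hausdorff1_pre_def by (rule INF_superset_mono) (auto intro: order_trans)

lemma hausdorff1_mono: "A \<subseteq> B \<Longrightarrow> hausdorff1 A \<le> hausdorff1 B"
  unfolding hausdorff1_def by (intro SUP_mono' hausdorff1_pre_mono)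

lemma hausdorff1_pre_le_suminf:
  assumes "A \<subseteq> (\<Union>i. C i)" "\<And>i. bounded (C i)" "\<And>i. diameter (C i) \<le> \<delta>"
  shows "hausdorff1_pre \<delta> A \<le> (\<Sum>i. ennreal (diameter (C i)))"
  unfolding hausdorff1_pre_def using assms by (intro INF_lower) auto

lemma hausdorff1_pre_le_hausdorff1: "0 < \<delta> \<Longrightarrow> hausdorff1_pre \<delta> A \<le> hausdorff1 A"
  unfolding hausdorff1_def by (intro SUP_upper) auto

lemma hausdorff1_pre_approx:
  assumes "hausdorff1_pre \<delta> A < x"
  obtains C where "A \<subseteq> (\<Union>i. C i)" "\<And>i. bounded (C i)" "\<And>i. diameter (C i) \<le> \<delta>"
    "(\<Sum>i. ennreal (diameter (C i))) < x"
  using assms that unfolding hausdorff1_pre_def INF_less_iff by blast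

text \<open>Two covers are merged by putting one on the even and the other on the odd indices. A
  partial sum of the merged series is bounded by one of even length, which splits exactly.\<close>

lemma hausdorff1_pre_Un_le:
  "hausdorff1_pre \<delta> (A \<union> B) \<le> hausdorff1_pre \<delta> A + hausdorff1_pre \<delta> B"
proof (rule ennreal_le_epsilon)
  fix e :: real
  assume fin: "hausdorff1_pre \<delta> A + hausdorff1_pre \<delta> B < top" and e: "0 < e"
  have "hausdorff1_pre \<delta> A < hausdorff1_pre \<delta> A + ennreal (e / 2)"
       "hausdorff1_pre \<delta> B < hausdorff1_pre \<delta> B + ennreal (e / 2)"
    using fin e by (auto simp: ennreal_zero_less_divide)
  then obtain C D where C: "A \<subseteq> (\<Union>i. C i)" "\<And>i. bounded (C i)" "\<And>i. diameter (C i) \<le> \<delta>"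
      "(\<Sum>i. ennreal (diameter (C i))) < hausdorff1_pre \<delta> A + ennreal (e / 2)"
    and D: "B \<subseteq> (\<Union>i. D i)" "\<And>i. bounded (D i)" "\<And>i. diameter (D i) \<le> \<delta>"
      "(\<Sum>i. ennreal (diameter (D i))) < hausdorff1_pre \<delta> B + ennreal (e / 2)"
    by (metis hausdorff1_pre_approx)
  define E where "E i = (if even i then C (i div 2) else D (i div 2))" for i :: nat
  have EC: "E (2 * i) = C i" and ED: "E (2 * i + 1) = D i" for i by (auto simp: E_def)
  have "(\<Sum>i<2 * n. ennreal (diameter (E i)))
      = (\<Sum>i<n. ennreal (diameter (C i))) + (\<Sum>i<n. ennreal (diameter (D i)))" for n
    by (induction n) (use EC ED in \<open>auto simp: algebra_simps\<close>)
  then have *: "(\<Sum>i<n. ennreal (diameter (E i)))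
      \<le> (\<Sum>i. ennreal (diameter (C i))) + (\<Sum>i. ennreal (diameter (D i)))" for n
    using sum_mono2[of "{..<2 * n}" "{..<n}" "\<lambda>i. ennreal (diameter (E i))"]
    by (auto intro!: order_trans[OF _ add_mono[OF sum_le_suminf sum_le_suminf]])
  have "hausdorff1_pre \<delta> (A \<union> B) \<le> (\<Sum>i. ennreal (diameter (E i)))"
  proof (rule hausdorff1_pre_le_suminf)
    show "A \<union> B \<subseteq> (\<Union>i. E i)"
      using C(1) D(1) by (auto simp: subset_iff) (metis EC, metis ED)
  qed (use C D in \<open>auto simp: E_def\<close>)
  also have "\<dots> \<le> (\<Sum>i. ennreal (diameter (C i))) + (\<Sum>i. ennreal (diameter (D i)))"
    unfolding suminf_eq_SUP[of "\<lambda>i. ennreal (diameter (E i))"] by (rule SUP_least) (rule *)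
  also have "\<dots> \<le> (hausdorff1_pre \<delta> A + ennreal (e / 2)) + (hausdorff1_pre \<delta> B + ennreal (e / 2))"
    using C(4) D(4) by (intro add_mono) auto
  also have "\<dots> = hausdorff1_pre \<delta> A + hausdorff1_pre \<delta> B + ennreal e"
    using e by (simp add: algebra_simps flip: ennreal_plus)
  finally show "hausdorff1_pre \<delta> (A \<union> B) \<le> hausdorff1_pre \<delta> A + hausdorff1_pre \<delta> B + ennreal e" .
qed

lemma hausdorff1_Un_le: "hausdorff1 (A \<union> B) \<le> hausdorff1 A + hausdorff1 B"
proof -
  have "hausdorff1_pre \<delta> (A \<union> B) \<le> hausdorff1 A + hausdorff1 B" if "0 < \<delta>" for \<delta>
    using hausdorff1_pre_Un_le[of \<delta> A B] hausdorff1_pre_le_hausdorff1[OF that]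
    by (meson add_mono order_trans)
  then show ?thesis unfolding hausdorff1_def[of "A \<union> B"] by (intro SUP_least) auto
qed

text \<open>A cover of mesh below \<open>\<rho>\<close> has no set meeting both parts, so it splits
  into a cover of \<open>A\<close> and one of \<open>B\<close>. This stands in for additivity
  without any measurability argument.\<close>

lemma hausdorff1_separated:
  assumes "0 < \<rho>" and sep: "\<And>x y. x \<in> A \<Longrightarrow> y \<in> B \<Longrightarrow> \<rho> \<le> dist x y"
  shows "hausdorff1 A + hausdorff1 B \<le> hausdorff1 (A \<union> B)"
proof -
  have pre: "hausdorff1_pre \<delta> A + hausdorff1_pre \<delta> B \<le> hausdorff1_pre \<delta> (A \<union> B)" if "\<delta> < \<rho>" for \<delta>
    unfolding hausdorff1_pre_def[of \<delta> "A \<union> B"]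
  proof (rule INF_greatest)
    fix C :: "nat \<Rightarrow> 'a set"
    assume "C \<in> {C. A \<union> B \<subseteq> (\<Union>i. C i) \<and> (\<forall>i. bounded (C i) \<and> diameter (C i) \<le> \<delta>)}"
    then have C: "A \<union> B \<subseteq> (\<Union>i. C i)" "\<And>i. bounded (C i)" "\<And>i. diameter (C i) \<le> \<delta>" by auto
    define CA where "CA i = (if C i \<inter> A = {} then {} else C i)" for i
    define CB where "CB i = (if C i \<inter> B = {} then {} else C i)" for i
    have diam0: "0 \<le> \<delta>" by (rule order_trans[OF diameter_ge_0[OF C(2)] C(3)])
    have disj: "C i \<inter> A = {} \<or> C i \<inter> B = {}" for i
    proof (rule ccontr)
      assume "\<not> ?thesis"
      then obtain x y where xy: "x \<in> C i" "x \<in> A" "y \<in> C i" "y \<in> B" by blast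
      then show False
        using diameter_bounded_bound[OF C(2) xy(1,3)] sep[OF xy(2,4)] C(3)[of i] \<open>\<delta> < \<rho>\<close> by simp
    qed
    have CA: "A \<subseteq> (\<Union>i. CA i)"
    proof
      fix x assume "x \<in> A"
      moreover from this C(1) obtain i where "x \<in> C i" by blast
      ultimately have "x \<in> CA i" unfolding CA_def by auto
      then show "x \<in> (\<Union>i. CA i)" by blast
    qed
    have CB: "B \<subseteq> (\<Union>i. CB i)"
    proof
      fix x assume "x \<in> B"
      moreover from this C(1) obtain i where "x \<in> C i" by blast
      ultimately have "x \<in> CB i" unfolding CB_def by auto
      then show "x \<in> (\<Union>i. CB i)" by blast
    qed
    have "bounded (CA i)" "bounded (CB i)" "diameter (CA i) \<le> \<delta>" "diameter (CB i) \<le> \<delta>" for i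
      using C(2,3) diam0 by (simp_all add: CA_def CB_def)
    then have "hausdorff1_pre \<delta> A + hausdorff1_pre \<delta> B
        \<le> (\<Sum>i. ennreal (diameter (CA i))) + (\<Sum>i. ennreal (diameter (CB i)))"
      by (intro add_mono hausdorff1_pre_le_suminf[OF CA] hausdorff1_pre_le_suminf[OF CB])
    also have "\<dots> = (\<Sum>i. ennreal (diameter (CA i)) + ennreal (diameter (CB i)))"
      by (rule suminf_add[OF summableI summableI])
    also have "\<dots> \<le> (\<Sum>i. ennreal (diameter (C i)))"
    proof (rule suminf_le)
      show "ennreal (diameter (CA i)) + ennreal (diameter (CB i)) \<le> ennreal (diameter (C i))" for i
        using disj[of i] by (auto simp: CA_def CB_def)
    qed auto
    finally show "hausdorff1_pre \<delta> A + hausdorff1_pre \<delta> B \<le> (\<Sum>i. ennreal (diameter (C i)))" .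
  qed
  have "hausdorff1 A + hausdorff1 B
      = (SUP \<delta>\<in>{0<..}. hausdorff1_pre \<delta> A + hausdorff1_pre \<delta> B)"
    unfolding hausdorff1_def
  proof (rule SUP_add_directed_ennreal[symmetric])
    fix i j :: real assume "i \<in> {0<..}" "j \<in> {0<..}"
    then show "\<exists>k\<in>{0<..}. hausdorff1_pre i A + hausdorff1_pre j B \<le> hausdorff1_pre k A + hausdorff1_pre k B"
      by (intro bexI[of _ "min i j"] add_mono hausdorff1_pre_antimono) simp_all
  qed
  also have "\<dots> \<le> hausdorff1 (A \<union> B)"
  proof (rule SUP_least)
    fix \<delta> :: real assume \<delta>: "\<delta> \<in> {0<..}"
    define \<delta>' where "\<delta>' = min \<delta> (\<rho> / 2)"
    have "hausdorff1_pre \<delta> A + hausdorff1_pre \<delta> B \<le> hausdorff1_pre \<delta>' A + hausdorff1_pre \<delta>' B"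
      by (intro add_mono hausdorff1_pre_antimono) (auto simp: \<delta>'_def)
    also have "\<dots> \<le> hausdorff1_pre \<delta>' (A \<union> B)" using \<open>0 < \<rho>\<close> by (intro pre) (auto simp: \<delta>'_def)
    also have "\<dots> \<le> hausdorff1 (A \<union> B)"
      using \<open>0 < \<rho>\<close> \<delta> by (intro hausdorff1_pre_le_hausdorff1) (auto simp: \<delta>'_def)
    finally show "hausdorff1_pre \<delta> A + hausdorff1_pre \<delta> B \<le> hausdorff1 (A \<union> B)" .
  qed
  finally show ?thesis .
qed

text \<open>\<open>dist x\<close> does not increase distances, so it maps each covering set into an
  interval no longer than its diameter. By connectedness these intervals cover
  \<open>{0..dist x y}\<close>, and Lebesgue measure is subadditive.\<close>

lemma dist_le_hausdorff1:
  assumes "connected S" "x \<in> S" "y \<in> S"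
  shows "ennreal (dist x y) \<le> hausdorff1 S"
proof -
  have "ennreal (dist x y) \<le> hausdorff1_pre 1 S"
    unfolding hausdorff1_pre_def
  proof (rule INF_greatest)
    fix C :: "nat \<Rightarrow> 'a set"
    assume "C \<in> {C. S \<subseteq> (\<Union>i. C i) \<and> (\<forall>i. bounded (C i) \<and> diameter (C i) \<le> 1)}"
    then have C: "S \<subseteq> (\<Union>i. C i)" "\<And>i. bounded (C i)" by auto
    have "\<exists>J. closed J \<and> dist x ` C i \<subseteq> J \<and> emeasure lborel J \<le> ennreal (diameter (C i))" for i
    proof (cases "C i = {}")
      case False
      have lip: "dist x u \<le> dist x v + diameter (C i)" if "u \<in> C i" "v \<in> C i" for u v
        using diameter_bounded_bound[OF C(2) that] dist_triangle[of x u v] by (simp add: dist_commute)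
      define a where "a = (INF u\<in>C i. dist x u)"
      have a: "a \<le> dist x u" if "u \<in> C i" for u
        unfolding a_def by (rule cINF_lower[OF _ that]) (auto intro!: bdd_belowI[of _ 0])
      have b: "dist x u \<le> a + diameter (C i)" if "u \<in> C i" for u
      proof -
        have "dist x u - diameter (C i) \<le> a"
          unfolding a_def using lip[OF that] False by (intro cINF_greatest) (auto simp: algebra_simps)
        then show ?thesis by simp
      qed
      show ?thesis
        by (intro exI[of _ "{a..a + diameter (C i)}"]) (use a b diameter_ge_0[OF C(2), of i] in auto)
    qed auto
    then obtain J where J: "\<And>i. closed (J i)" "\<And>i. dist x ` C i \<subseteq> J i"
      "\<And>i. emeasure lborel (J i) \<le> ennreal (diameter (C i))" by metis
    have conn: "connected (dist x ` S)"
      by (intro connected_continuous_image continuous_intros assms)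
    have "{0..dist x y} \<subseteq> dist x ` S"
      using connected_contains_Icc[OF conn, of 0 "dist x y"] assms(2,3) by (metis dist_self imageI)
    also have "\<dots> \<subseteq> (\<Union>i. J i)" using C(1) J(2) by blast
    finally have "{0..dist x y} \<subseteq> (\<Union>i. J i)" .
    then have "emeasure lborel {0..dist x y} \<le> emeasure lborel (\<Union>i. J i)"
      using J(1) by (intro emeasure_mono) auto
    also have "\<dots> \<le> (\<Sum>i. emeasure lborel (J i))"
      using J(1) by (intro emeasure_subadditive_countably) auto
    also have "\<dots> \<le> (\<Sum>i. ennreal (diameter (C i)))" by (intro suminf_le J(3)) auto
    finally show "ennreal (dist x y) \<le> (\<Sum>i. ennreal (diameter (C i)))" by simp
  qed
  also have "\<dots> \<le> hausdorff1 S" by (rule hausdorff1_pre_le_hausdorff1) simp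
  finally show ?thesis .
qed

text \<open>The images of \<open>n\<close> equal subintervals have diameter at most
  \<open>K * h\<close>, and these bounds add up to exactly \<open>K * (b - a)\<close> for every
  \<open>n\<close>; a large \<open>n\<close> meets the mesh requirement.\<close>

lemma hausdorff1_lipschitz_image_le:
  fixes f :: "real \<Rightarrow> 'a::metric_space"
  assumes f: "K-lipschitz_on {a..b} f" and "a \<le> b"
  shows "hausdorff1 (f ` {a..b}) \<le> ennreal (K * (b - a))"
  unfolding hausdorff1_def
proof (rule SUP_least)
  fix \<delta> :: real assume "\<delta> \<in> {0<..}"
  then have "0 < \<delta>" by simp
  have K: "0 \<le> K" using f by (rule lipschitz_on_nonneg)
  obtain n :: nat where n: "n > 0" "K * (b - a) / \<delta> < real n"
  proof -
    obtain m :: nat where "K * (b - a) / \<delta> < real m" using reals_Archimedean2 by blast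
    then show ?thesis using that[of "Suc m"] by simp
  qed
  define h where "h = (b - a) / n"
  have h: "0 \<le> h" using \<open>a \<le> b\<close> by (simp add: h_def)
  have nh: "n * h = b - a" using n by (simp add: h_def)
  have Kh: "K * h \<le> \<delta>" using n \<open>0 < \<delta>\<close> by (simp add: h_def field_simps)
  define C where "C i = (if i < n then f ` {a + i * h..a + Suc i * h} else {})" for i
  have sub: "{a + i * h..a + Suc i * h} \<subseteq> {a..b}" if "i < n" for i
  proof -
    have "Suc i * h \<le> n * h" using that h by (intro mult_right_mono) auto
    then show ?thesis using nh h by (auto simp del: of_nat_Suc)
  qed
  have lip: "dist u v \<le> K * h" if uv: "u \<in> C i" "v \<in> C i" for i u v
  proof -
    obtain s t where st: "i < n" "s \<in> {a + i * h..a + Suc i * h}" "t \<in> {a + i * h..a + Suc i * h}" "u = f s" "v = f t"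
      using uv by (auto simp: C_def split: if_splits)
    have "dist u v \<le> K * dist s t"
      using st sub[OF st(1)] lipschitz_onD[OF f, of s t] by blast
    also have "\<dots> \<le> K * h" using st K by (intro mult_left_mono) (auto simp: dist_real_def algebra_simps)
    finally show ?thesis .
  qed
  have diam: "diameter (C i) \<le> K * h" for i
  proof (cases "C i = {}")
    case False
    then show ?thesis unfolding diameter_def using lip by (auto intro!: cSUP_least)
  qed (use h K in simp)
  have bdd: "bounded (C i)" for i
  proof (cases "C i = {}")
    case False
    then obtain u where "u \<in> C i" by blast
    with lip show ?thesis unfolding bounded_def by blast
  qed simp
  have "hausdorff1_pre \<delta> (f ` {a..b}) \<le> (\<Sum>i. ennreal (diameter (C i)))"
  proof (rule hausdorff1_pre_le_suminf)
    show "f ` {a..b} \<subseteq> (\<Union>i. C i)"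
    proof
      fix y assume "y \<in> f ` {a..b}"
      then obtain x where x: "x \<in> {a..b}" "y = f x" by blast
      show "y \<in> (\<Union>i. C i)"
      proof (cases "x = b")
        case True
        \<comment> \<open>The floor used below would give index \<open>n\<close> at the right end
          point, so \<open>b\<close> is assigned to the last piece.\<close>
        have "x \<in> {a + (n - 1) * h..a + Suc (n - 1) * h}" using True n nh h by (auto simp: algebra_simps)
        then have "y \<in> C (n - 1)" using n x(2) by (auto simp: C_def)
        then show ?thesis by blast
      next
        case False
        then have "a \<le> x" "x < b" using x by auto
        then have hp: "0 < h" using n by (simp add: h_def)
        define i where "i = nat \<lfloor>(x - a) / h\<rfloor>"
        have i: "real i \<le> (x - a) / h" "(x - a) / h < real i + 1"
          using \<open>a \<le> x\<close> hp by (simp_all add: i_def)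
        have "real i * h \<le> x - a" using i(1) hp by (simp add: field_simps)
        also have "\<dots> < real n * h" using nh \<open>x < b\<close> by simp
        finally have "i < n" using hp by simp
        moreover have "x \<in> {a + i * h..a + Suc i * h}" using i hp by (simp add: field_simps)
        ultimately have "y \<in> C i" using x(2) by (auto simp: C_def)
        then show ?thesis by blast
      qed
    qed
    show "diameter (C i) \<le> \<delta>" for i using diam[of i] Kh by simp
  qed (rule bdd)
  also have "\<dots> = (\<Sum>i<n. ennreal (diameter (C i)))"
    by (rule suminf_finite) (auto simp: C_def)
  also have "\<dots> \<le> (\<Sum>i<n. ennreal (K * h))" by (intro sum_mono ennreal_leI diam)
  also have "\<dots> = ennreal (K * (b - a))"
  proof -
    have "real n * (K * h) = K * (b - a)" unfolding nh[symmetric] by simp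
    moreover have "ennreal (real n * (K * h)) = ennreal (real n) * ennreal (K * h)"
      using K h by (intro ennreal_mult) simp_all
    ultimately have "ennreal (real n) * ennreal (K * h) = ennreal (K * (b - a))" by (simp only:)
    then show ?thesis by (simp add: ennreal_of_nat_eq_real_of_nat)
  qed
  finally show "hausdorff1_pre \<delta> (f ` {a..b}) \<le> ennreal (K * (b - a))" .
qed

subsection \<open>Rigidity of the constant-speed parametrization\<close>

text \<open>Points mapped to 0 and 1 are at distance at least 1, hence are the two ends; the
  Lipschitz bounds from both ends then leave one possible value.\<close>

lemma lipschitz_surj_unit_interval:
  fixes \<phi> :: "real \<Rightarrow> real"
  assumes lip: "1-lipschitz_on {0..1} \<phi>" and surj: "\<phi> ` {0..1} = {0..1}"
  shows "(\<forall>s\<in>{0..1}. \<phi> s = s) \<or> (\<forall>s\<in>{0..1}. \<phi> s = 1 - s)"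
proof -
  have lip': "\<bar>\<phi> s - \<phi> t\<bar> \<le> \<bar>s - t\<bar>" if "s \<in> {0..1}" "t \<in> {0..1}" for s t
    using lipschitz_onD[OF lip that] by (simp add: dist_real_def)
  have "0 \<in> \<phi> ` {0..1}" "1 \<in> \<phi> ` {0..1}" using surj by auto
  then obtain u v where uv: "u \<in> {0..1}" "\<phi> u = 0" "v \<in> {0..1}" "\<phi> v = 1" by (elim imageE) simp
  have "(u = 0 \<and> v = 1) \<or> (u = 1 \<and> v = 0)" using lip'[OF uv(1,3)] uv by auto
  then show ?thesis
  proof
    assume "u = 0 \<and> v = 1"
    then have "\<phi> s = s" if "s \<in> {0..1}" for s
      using lip'[OF that uv(1)] lip'[OF that uv(3)] uv that by auto
    then show ?thesis by blast
  next
    assume "u = 1 \<and> v = 0"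
    then have "\<phi> s = 1 - s" if "s \<in> {0..1}" for s
      using lip'[OF that uv(1)] lip'[OF that uv(3)] uv that by auto
    then show ?thesis by blast
  qed
qed

context
  fixes \<gamma> :: "real \<Rightarrow> 'a::euclidean_space" and \<Gamma> :: "'a set" and l :: real
  assumes par: "normalized_constant_speed_param \<gamma> \<Gamma>" and l: "hausdorff1 \<Gamma> = ennreal l"
begin

lemma param_cont: "continuous_on {0..1} \<gamma>" and param_inj: "inj_on \<gamma> {0..1}" and param_image: "\<gamma> ` {0..1} = \<Gamma>"
  and param_length: "t \<in> {0..1} \<Longrightarrow> hausdorff1 (\<gamma> ` {0..t}) = ennreal t * ennreal l"
  using par l unfolding normalized_constant_speed_param_def by auto

lemma param_ends: "\<gamma> 0 \<noteq> \<gamma> 1"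
  using param_inj by (auto dest: inj_onD)

text \<open>\<open>ennreal\<close> sends every nonpositive real to 0, so the equation for \<Gamma>
  alone does not show the sign of \<open>l\<close>; it follows from the distance of the distinct end
  points.\<close>

lemma param_length_pos: "0 < l"
proof -
  have "connected (\<gamma> ` {0..1})" by (intro connected_continuous_image param_cont) auto
  from dist_le_hausdorff1[OF this, of "\<gamma> 0" "\<gamma> 1"]
  have le: "ennreal (dist (\<gamma> 0) (\<gamma> 1)) \<le> hausdorff1 \<Gamma>" by (simp add: param_image[symmetric])
  show ?thesis
  proof (rule ccontr)
    assume "\<not> 0 < l"
    then show False using le l param_ends by (simp add: ennreal_neg)
  qed
qed

text \<open>The definition measures initial arcs only. To subtract one, a gap of parameter length
  \<open>d\<close> before \<open>s\<close> is left out: the two arcs are then disjoint compact sets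
  at positive distance, and their measures add. The gap costs at most
  \<open>d * l \<le> e\<close>.\<close>

lemma param_arc_length_le:
  assumes "0 \<le> s" "s \<le> t" "t \<le> 1"
  shows "hausdorff1 (\<gamma> ` {s..t}) \<le> ennreal ((t - s) * l)"
proof (rule ennreal_le_epsilon)
  fix e :: real assume "0 < e"
  have lp: "0 < l" by (rule param_length_pos)
  show "hausdorff1 (\<gamma> ` {s..t}) \<le> ennreal ((t - s) * l) + ennreal e"
  proof (cases "s = 0")
    case True
    then show ?thesis using param_length[of t] assms lp by (simp add: ennreal_mult[symmetric])
  next
    case False
    define d where "d = min s (e / l)"
    have d: "0 < d" "d \<le> s" "d * l \<le> e" using False assms \<open>0 < e\<close> lp
      by (auto simp: d_def field_simps min_def)
    have c: "compact (\<gamma> ` {0..s - d})" "compact (\<gamma> ` {s..t})"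
      using assms d by (auto intro!: compact_continuous_image continuous_on_subset[OF param_cont])
    have dis: "\<gamma> ` {0..s - d} \<inter> \<gamma> ` {s..t} = {}"
    proof -
      have "\<gamma> ` {0..s - d} \<inter> \<gamma> ` {s..t} = \<gamma> ` ({0..s - d} \<inter> {s..t})"
        by (rule inj_on_image_Int[OF param_inj, symmetric]) (use assms d in auto)
      also have "{0..s - d} \<inter> {s..t} = {}" using d by auto
      finally show ?thesis by simp
    qed
    obtain \<rho> where \<rho>: "0 < \<rho>" "\<And>x y. x \<in> \<gamma> ` {0..s - d} \<Longrightarrow> y \<in> \<gamma> ` {s..t} \<Longrightarrow> \<rho> \<le> dist x y"
      using separate_compact_closed[OF c(1) compact_imp_closed[OF c(2)] dis] by metis
    have "ennreal (s - d) * ennreal l + hausdorff1 (\<gamma> ` {s..t})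
        = hausdorff1 (\<gamma> ` {0..s - d}) + hausdorff1 (\<gamma> ` {s..t})"
      using assms d by (subst param_length) auto
    also have "\<dots> \<le> hausdorff1 (\<gamma> ` {0..s - d} \<union> \<gamma> ` {s..t})" by (rule hausdorff1_separated[OF \<rho>])
    also have "\<dots> \<le> hausdorff1 (\<gamma> ` {0..t})" by (rule hausdorff1_mono) (use assms d in auto)
    also have "\<dots> = ennreal t * ennreal l" using assms by (intro param_length) auto
    also have "\<dots> = ennreal (s - d) * ennreal l + ennreal ((t - s + d) * l)"
    proof -
      have "t * l = (s - d) * l + (t - s + d) * l" by (simp add: algebra_simps)
      then show ?thesis using assms d lp by (simp flip: ennreal_mult ennreal_plus)
    qed
    finally have "hausdorff1 (\<gamma> ` {s..t}) \<le> ennreal ((t - s + d) * l)"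
      using d by (simp add: ennreal_add_left_cancel_le ennreal_mult_eq_top_iff)
    also have "\<dots> \<le> ennreal ((t - s) * l + e)" using d by (intro ennreal_leI) (simp add: algebra_simps)
    also have "\<dots> = ennreal ((t - s) * l) + ennreal e" using assms lp \<open>0 < e\<close> by (simp add: ennreal_plus)
    finally show ?thesis .
  qed
qed

lemma param_arc_length_ge:
  assumes "0 \<le> s" "s \<le> t" "t \<le> 1"
  shows "ennreal ((t - s) * l) \<le> hausdorff1 (\<gamma> ` {s..t})"
proof -
  have lp: "0 < l" by (rule param_length_pos)
  have "ennreal s * ennreal l + ennreal ((t - s) * l) = ennreal t * ennreal l"
    using assms lp by (simp add: algebra_simps flip: ennreal_mult ennreal_plus)
  also have "\<dots> = hausdorff1 (\<gamma> ` {0..t})" using assms by (intro param_length[symmetric]) auto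
  also have "{0..t} = {0..s} \<union> {s..t}" using assms by auto
  also have "hausdorff1 (\<gamma> ` ({0..s} \<union> {s..t})) \<le> hausdorff1 (\<gamma> ` {0..s}) + hausdorff1 (\<gamma> ` {s..t})"
    by (simp add: image_Un hausdorff1_Un_le)
  also have "hausdorff1 (\<gamma> ` {0..s}) = ennreal s * ennreal l" using assms by (intro param_length) auto
  finally show ?thesis by (simp add: ennreal_add_left_cancel_le ennreal_mult_eq_top_iff)
qed

text \<open>A chord is no longer than its arc, and arc length is proportional to parameter
  length.\<close>

lemma param_lipschitz: "l-lipschitz_on {0..1} \<gamma>"
proof (rule lipschitz_on_leI)
  fix s t :: real assume st: "s \<in> {0..1}" "t \<in> {0..1}" "s \<le> t"
  have "connected (\<gamma> ` {s..t})"
    using st by (intro connected_continuous_image continuous_on_subset[OF param_cont]) auto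
  then have "ennreal (dist (\<gamma> s) (\<gamma> t)) \<le> hausdorff1 (\<gamma> ` {s..t})"
    using st by (intro dist_le_hausdorff1) auto
  also have "\<dots> \<le> ennreal ((t - s) * l)" using st by (intro param_arc_length_le) auto
  finally show "dist (\<gamma> s) (\<gamma> t) \<le> l * dist s t"
    using st param_length_pos by (simp add: dist_real_def mult.commute)
qed (use param_length_pos in simp)

text \<open>A detour of \<open>\<sigma>\<close> outside \<open>\<Gamma>\<close> would leave too little length to cover \<open>\<Gamma>\<close>.\<close>

lemma lipschitz_cover_subset:
  fixes \<sigma> :: "real \<Rightarrow> 'a"
  assumes \<sigma>: "l-lipschitz_on {0..1} \<sigma>" and cov: "\<Gamma> \<subseteq> \<sigma> ` {0..1}"
  shows "\<sigma> ` {0..1} \<subseteq> \<Gamma>"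
proof (rule ccontr)
  assume "\<not> ?thesis"
  then obtain s where s: "s \<in> {0..1}" "\<sigma> s \<notin> \<Gamma>" by blast
  have lp: "0 < l" by (rule param_length_pos)
  have "compact \<Gamma>" using compact_continuous_image[OF param_cont] by (simp add: param_image)
  then have "closed \<Gamma>" by (rule compact_imp_closed)
  then obtain \<rho> where \<rho>: "0 < \<rho>" "\<And>y. y \<in> \<Gamma> \<Longrightarrow> \<rho> \<le> dist (\<sigma> s) y"
    using separate_point_closed[OF _ s(2)] by metis
  \<comment> \<open>A parameter that \<sigma> sends into \<Gamma> is at distance at least
    \<open>\<rho> / l\<close> from \<open>s\<close>, so half that radius can be cut out around
    \<open>s\<close> without uncovering \<Gamma>. Clipping to the unit interval keeps
    \<open>a < b\<close>.\<close>
  define a where "a = max 0 (s - \<rho> / (2 * l))"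
  define b where "b = min 1 (s + \<rho> / (2 * l))"
  have \<rho>l: "0 < \<rho> / (2 * l)" using \<rho>(1) lp by simp
  have ab: "0 \<le> a" "a \<le> s" "s \<le> b" "b \<le> 1" "a < b" using s(1) \<rho>l by (auto simp: a_def b_def)
  have "\<Gamma> \<subseteq> \<sigma> ` {0..a} \<union> \<sigma> ` {b..1}"
  proof
    fix y assume y: "y \<in> \<Gamma>"
    then obtain t where t: "t \<in> {0..1}" "y = \<sigma> t" using cov by blast
    have "\<rho> \<le> l * dist s t" using \<rho>(2)[OF y] lipschitz_onD[OF \<sigma> s(1) t(1)] t(2) by simp
    then have "\<rho> / l \<le> dist s t" using lp by (simp add: field_simps)
    then have "t \<le> s - \<rho> / (2 * l) \<or> s + \<rho> / (2 * l) \<le> t"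
      using \<rho>l by (auto simp: dist_real_def field_simps abs_if split: if_splits)
    then have "t \<in> {0..a} \<union> {b..1}" using t(1) by (auto simp: a_def b_def)
    then show "y \<in> \<sigma> ` {0..a} \<union> \<sigma> ` {b..1}" using t(2) by blast
  qed
  then have "ennreal l \<le> hausdorff1 (\<sigma> ` {0..a} \<union> \<sigma> ` {b..1})" using hausdorff1_mono[of \<Gamma>] by (simp add: l)
  also have "\<dots> \<le> hausdorff1 (\<sigma> ` {0..a}) + hausdorff1 (\<sigma> ` {b..1})" by (rule hausdorff1_Un_le)
  also have "\<dots> \<le> ennreal (l * (a - 0)) + ennreal (l * (1 - b))"
    using ab by (intro add_mono hausdorff1_lipschitz_image_le lipschitz_on_subset[OF \<sigma>]) auto
  also have "\<dots> = ennreal (l * (1 - (b - a)))" using ab lp by (simp add: algebra_simps flip: ennreal_plus)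
  finally have "l \<le> l * (1 - (b - a))" using ab lp by (simp add: ennreal_le_iff)
  then show False using ab lp by (simp add: algebra_simps)
qed

text \<open>With \<phi> as \<gamma> inverse after \<sigma>, the intermediate value property makes
  \<sigma> on \<open>{s..t}\<close> cover the arc of \<gamma> between the parameters
  \<open>\<phi> s\<close> and \<open>\<phi> t\<close>. Comparing the lengths of the two shows that
  \<phi> is 1-Lipschitz.\<close>

lemma lipschitz_cover_rigid:
  fixes \<sigma> :: "real \<Rightarrow> 'a"
  assumes \<sigma>: "l-lipschitz_on {0..1} \<sigma>" and cov: "\<Gamma> \<subseteq> \<sigma> ` {0..1}"
  shows "(\<forall>s\<in>{0..1}. \<sigma> s = \<gamma> s) \<or> (\<forall>s\<in>{0..1}. \<sigma> s = \<gamma> (1 - s))"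
proof -
  have lp: "0 < l" by (rule param_length_pos)
  have im: "\<sigma> ` {0..1} = \<Gamma>" using lipschitz_cover_subset[OF \<sigma> cov] cov by blast
  define \<psi> where "\<psi> = inv_into {0..1} \<gamma>"
  have \<psi>\<gamma>: "\<psi> (\<gamma> s) = s" if "s \<in> {0..1}" for s
    unfolding \<psi>_def using param_inj that by simp
  have \<gamma>\<psi>: "\<gamma> (\<psi> x) = x" "\<psi> x \<in> {0..1}" if "x \<in> \<Gamma>" for x
    using that inv_into_into[of x \<gamma> "{0..1}"] by (simp_all add: \<psi>_def param_image f_inv_into_f)
  have \<psi>cont: "continuous_on \<Gamma> \<psi>"
    using continuous_on_inv[OF param_cont, of \<psi>] \<psi>\<gamma> by (simp add: param_image)
  define \<phi> where "\<phi> s = \<psi> (\<sigma> s)" for s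
  have \<sigma>\<phi>: "\<gamma> (\<phi> s) = \<sigma> s" "\<phi> s \<in> {0..1}" if "s \<in> {0..1}" for s
    using that im \<gamma>\<psi>[of "\<sigma> s"] by (auto simp: \<phi>_def)
  have \<phi>cont: "continuous_on {0..1} \<phi>"
    unfolding \<phi>_def using continuous_on_compose2[OF \<psi>cont lipschitz_on_continuous_on[OF \<sigma>]] im by simp
  have "1-lipschitz_on {0..1} \<phi>"
  proof (rule lipschitz_on_leI)
    fix s t :: real assume st: "s \<in> {0..1}" "t \<in> {0..1}" "s \<le> t"
    define a where "a = min (\<phi> s) (\<phi> t)"
    define b where "b = max (\<phi> s) (\<phi> t)"
    have ab: "0 \<le> a" "a \<le> b" "b \<le> 1" using \<sigma>\<phi>(2)[OF st(1)] \<sigma>\<phi>(2)[OF st(2)] by (auto simp: a_def b_def)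
    have conn: "connected (\<phi> ` {s..t})"
      using st by (intro connected_continuous_image continuous_on_subset[OF \<phi>cont]) auto
    have "a \<in> \<phi> ` {s..t}" "b \<in> \<phi> ` {s..t}" using st(3) by (auto simp: a_def b_def min_def max_def)
    then have sub: "{a..b} \<subseteq> \<phi> ` {s..t}" by (rule connected_contains_Icc[OF conn])
    have sub': "\<gamma> ` {a..b} \<subseteq> \<sigma> ` {s..t}"
    proof
      fix y assume "y \<in> \<gamma> ` {a..b}"
      then obtain w where w: "w \<in> {s..t}" "y = \<gamma> (\<phi> w)" using sub by blast
      then show "y \<in> \<sigma> ` {s..t}" using \<sigma>\<phi>(1)[of w] st by auto
    qed
    have "ennreal ((b - a) * l) \<le> hausdorff1 (\<gamma> ` {a..b})" by (rule param_arc_length_ge[OF ab])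
    also have "\<dots> \<le> hausdorff1 (\<sigma> ` {s..t})" by (rule hausdorff1_mono[OF sub'])
    also have "\<dots> \<le> ennreal (l * (t - s))"
      using st by (intro hausdorff1_lipschitz_image_le lipschitz_on_subset[OF \<sigma>]) auto
    finally have "b - a \<le> t - s" using st lp by (simp add: ennreal_le_iff mult.commute)
    then show "dist (\<phi> s) (\<phi> t) \<le> 1 * dist s t"
      using st by (auto simp: dist_real_def a_def b_def min_def max_def split: if_splits)
  qed simp
  moreover have "\<phi> ` {0..1} = {0..1}"
  proof
    show "\<phi> ` {0..1} \<subseteq> {0..1}" using \<sigma>\<phi>(2) by blast
    show "{0..1} \<subseteq> \<phi> ` {0..1}"
    proof
      fix s :: real assume s: "s \<in> {0..1}"
      then have "\<gamma> s \<in> \<sigma> ` {0..1}" using im param_image by blast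
      then obtain w where "w \<in> {0..1}" "\<sigma> w = \<gamma> s" by force
      then show "s \<in> \<phi> ` {0..1}" using \<psi>\<gamma>[OF s] by (force simp: \<phi>_def)
    qed
  qed
  ultimately have "(\<forall>s\<in>{0..1}. \<phi> s = s) \<or> (\<forall>s\<in>{0..1}. \<phi> s = 1 - s)"
    by (rule lipschitz_surj_unit_interval)
  then show ?thesis
  proof (elim disjE)
    assume "\<forall>s\<in>{0..1}. \<phi> s = s"
    then have "\<sigma> s = \<gamma> s" if "s \<in> {0..1}" for s using \<sigma>\<phi>(1)[OF that] that by simp
    then show ?thesis by blast
  next
    assume "\<forall>s\<in>{0..1}. \<phi> s = 1 - s"
    then have "\<sigma> s = \<gamma> (1 - s)" if "s \<in> {0..1}" for s using \<sigma>\<phi>(1)[OF that] that by simp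
    then show ?thesis by blast
  qed
qed

end

subsection \<open>Compactness of inscribed polygons\<close>

text \<open>Piecewise linear interpolation with value \<open>p i\<close> at \<open>i / N\<close>. At
  \<open>x = 1\<close> the index is \<open>N\<close> and the weight of \<open>p (Suc N)\<close> is
  0, so no vertex beyond the last matters on the unit interval.\<close>

definition interp :: "nat \<Rightarrow> (nat \<Rightarrow> 'a::real_normed_vector) \<Rightarrow> real \<Rightarrow> 'a" where
  "interp N p x = (let i = nat \<lfloor>x * N\<rfloor> in p i + (x * N - i) *\<^sub>R (p (Suc i) - p i))"

lemma interp_node: "0 < N \<Longrightarrow> interp N p (i / N) = p i"
  by (simp add: interp_def)

text \<open>At the right end of a segment the floor already moves to the next one; both formulas
  give \<open>p (Suc i)\<close> there.\<close>

lemma interp_segment: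
  assumes "0 < N" "x \<in> {i / N..Suc i / N}"
  shows "interp N p x = p i + (x * N - i) *\<^sub>R (p (Suc i) - p i)"
proof (cases "x = Suc i / N")
  case True
  then show ?thesis using interp_node[OF assms(1), of p "Suc i"] assms(1) by simp
next
  case False
  then have "real i \<le> x * N" "x * N < real i + 1" using assms by (auto simp: field_simps)
  then have "\<lfloor>x * N\<rfloor> = int i" by (simp add: floor_eq_iff)
  then show ?thesis by (simp add: interp_def)
qed

lemma interp_lipschitz:
  assumes N: "0 < N" and p: "\<And>i. i < N \<Longrightarrow> dist (p i) (p (Suc i)) \<le> K / N"
  shows "K-lipschitz_on {0..1} (interp N p)"
proof (rule lipschitz_on_closed_Union[where I = "{..<N}" and U = "\<lambda>i. {real i / N..Suc i / N}"])
  have "0 \<le> K / N" using p[OF N] zero_le_dist order_trans by blast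
  then show "0 \<le> K" using N by (simp add: zero_le_divide_iff)
  show "K-lipschitz_on {real i / N..real (Suc i) / N} (interp N p)" if i: "i \<in> {..<N}" for i
  proof (rule lipschitz_onI)
    fix x y assume xy: "x \<in> {real i / N..real (Suc i) / N}" "y \<in> {real i / N..real (Suc i) / N}"
    have "interp N p x - interp N p y = (x * N - y * N) *\<^sub>R (p (Suc i) - p i)"
      unfolding interp_segment[OF N xy(1), of p] interp_segment[OF N xy(2), of p]
      by (simp flip: scaleR_left_diff_distrib)
    then have "dist (interp N p x) (interp N p y) = dist x y * N * dist (p i) (p (Suc i))"
      using N by (simp add: dist_norm norm_minus_commute abs_mult flip: left_diff_distrib)
    also have "\<dots> \<le> dist x y * N * (K / N)" using p[of i] i by (intro mult_left_mono) auto
    finally show "dist (interp N p x) (interp N p y) \<le> K * dist x y" using N by (simp add: mult.commute)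
  qed fact
  show "{0..1} \<subseteq> (\<Union>i\<in>{..<N}. {real i / N..real (Suc i) / N})"
  proof
    fix x :: real assume x: "x \<in> {0..1}"
    define i where "i = (if x = 1 then N - 1 else nat \<lfloor>x * N\<rfloor>)"
    have "i < N \<and> real i \<le> x * N \<and> x * N \<le> Suc i"
    proof (cases "x = 1")
      case False
      then have "x * N < N" "0 \<le> x * N" using x N by auto
      then show ?thesis using False by (auto simp: i_def) linarith+
    qed (use N in \<open>auto simp: i_def\<close>)
    then have "i \<in> {..<N}" "x \<in> {real i / N..real (Suc i) / N}" using N by (auto simp: field_simps)
    then show "x \<in> (\<Union>i\<in>{..<N}. {real i / N..real (Suc i) / N})" by blast
  qed
qed auto

text \<open>Meant for a sequence of supposed counterexamples, so one good \<open>k\<close> is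
  enough. A uniform limit of a subsequence is \<open>l\<close>-Lipschitz since \<open>K\<close>
  tends to \<open>l\<close>, and its closed range contains the dense set \<open>D\<close>, hence
  \<Gamma>. Of the two paths left by rigidity, the linear functional given by \<open>b\<close> rules
  out the reversed one.\<close>

lemma polygons_close:
  fixes \<gamma> :: "real \<Rightarrow> 'a::euclidean_space" and p :: "nat \<Rightarrow> nat \<Rightarrow> 'a"
  assumes par: "normalized_constant_speed_param \<gamma> \<Gamma>" "hausdorff1 \<Gamma> = ennreal l"
    and N: "\<And>k. 0 < N k" and K: "K \<longlonglongrightarrow> l"
    and step: "\<And>k i. i < N k \<Longrightarrow> dist (p k i) (p k (Suc i)) \<le> K k / N k"
    and bdd: "\<And>k i. i \<le> N k \<Longrightarrow> norm (p k i) \<le> M"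
    and dense: "\<Gamma> \<subseteq> closure D"
    and cov: "\<And>y e. y \<in> D \<Longrightarrow> 0 < e \<Longrightarrow> \<forall>\<^sub>F k in sequentially. \<exists>i\<le>N k. dist y (p k i) < e"
    and dir: "\<And>k. p k 0 \<bullet> b \<le> p k (N k) \<bullet> b" "\<gamma> 0 \<bullet> b < \<gamma> 1 \<bullet> b"
    and e: "0 < e"
  shows "\<exists>k. \<forall>i\<le>N k. dist (p k i) (\<gamma> (i / N k)) < e"
proof -
  define \<sigma> where "\<sigma> k = interp (N k) (p k)" for k
  have \<sigma>_node: "\<sigma> k (i / N k) = p k i" for k i using interp_node[OF N] by (simp add: \<sigma>_def)
  have node: "i / N k \<in> {0..1}" if "i \<le> N k" for i k using that N[of k] by simp
  have \<sigma>_lip: "(K k)-lipschitz_on {0..1} (\<sigma> k)" for k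
    unfolding \<sigma>_def using step by (rule interp_lipschitz[OF N])
  \<comment> \<open>Convergence bounds all the speeds \<open>K k\<close> at once, which gives
    equicontinuity.\<close>
  obtain B where B: "0 < B" "\<And>k. norm (K k) \<le> B" using BseqE[OF convergent_imp_Bseq[OF convergentI[OF K]]] by metis
  have \<sigma>_lip': "norm (\<sigma> k x - \<sigma> k y) \<le> B * \<bar>x - y\<bar>" if "x \<in> {0..1}" "y \<in> {0..1}" for k x y
  proof -
    have "norm (\<sigma> k x - \<sigma> k y) \<le> K k * \<bar>x - y\<bar>"
      using lipschitz_onD[OF \<sigma>_lip that] by (simp add: dist_norm)
    also have "\<dots> \<le> B * \<bar>x - y\<bar>" using B(2)[of k] by (intro mult_right_mono) auto
    finally show ?thesis .
  qed
  obtain g r where g: "continuous_on {0..1} g" and r: "strict_mono (r :: nat \<Rightarrow> nat)"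
    and unif: "\<And>e. 0 < e \<Longrightarrow> \<exists>n0. \<forall>n x. n0 \<le> n \<and> x \<in> {0..1} \<longrightarrow> norm (\<sigma> (r n) x - g x) < e"
  proof (rule Arzela_Ascoli[of "{0..1::real}" \<sigma> "M + B"])
    show "norm (\<sigma> n x) \<le> M + B" if "x \<in> {0..1}" for n x
    proof -
      have "norm (\<sigma> n x) \<le> norm (\<sigma> n 0) + norm (\<sigma> n x - \<sigma> n 0)" by (rule norm_triangle_sub)
      moreover have "norm (\<sigma> n 0) \<le> M" using bdd[of 0 n] \<sigma>_node[of n 0] by simp
      moreover have "norm (\<sigma> n x - \<sigma> n 0) \<le> B * 1"
        using \<sigma>_lip'[OF that, of 0 n] that B(1) by (intro order_trans[OF _ mult_left_mono[of "\<bar>x - 0\<bar>" 1 B]]) auto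
      ultimately show ?thesis by simp
    qed
    show "\<exists>d>0. \<forall>n y. y \<in> {0..1} \<and> norm (x - y) < d \<longrightarrow> norm (\<sigma> n x - \<sigma> n y) < e"
      if "x \<in> {0..1}" "0 < e" for x e
    proof (intro exI[of _ "e / B"] conjI allI impI)
      show "0 < e / B" using B(1) that(2) by simp
      fix n y assume "y \<in> {0..1} \<and> norm (x - y) < e / B"
      then have "B * \<bar>x - y\<bar> < e" "y \<in> {0..1}" using B(1) by (simp_all add: field_simps)
      then show "norm (\<sigma> n x - \<sigma> n y) < e" using \<sigma>_lip'[OF that(1), of y n] by simp
    qed
  qed auto
  have lim: "(\<lambda>n. \<sigma> (r n) x) \<longlonglongrightarrow> g x" if "x \<in> {0..1}" for x
  proof (rule LIMSEQ_I)
    fix e :: real assume "0 < e"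
    from unif[OF this] that show "\<exists>n0. \<forall>n\<ge>n0. norm (\<sigma> (r n) x - g x) < e" by blast
  qed
  have Kr: "(\<lambda>n. K (r n)) \<longlonglongrightarrow> l" using LIMSEQ_subseq_LIMSEQ[OF K r] by (simp add: comp_def)
  have "l-lipschitz_on {0..1} g"
  proof (rule lipschitz_onI)
    fix x y :: real assume xy: "x \<in> {0..1}" "y \<in> {0..1}"
    show "dist (g x) (g y) \<le> l * dist x y"
    proof (rule LIMSEQ_le)
      show "(\<lambda>n. dist (\<sigma> (r n) x) (\<sigma> (r n) y)) \<longlonglongrightarrow> dist (g x) (g y)" by (intro tendsto_dist lim xy)
      show "(\<lambda>n. K (r n) * dist x y) \<longlonglongrightarrow> l * dist x y" by (intro tendsto_mult Kr tendsto_const)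
    qed (use lipschitz_onD[OF \<sigma>_lip xy] in blast)
  qed (use param_length_pos[OF par] in simp)
  moreover have "\<Gamma> \<subseteq> g ` {0..1}"
  proof -
    have "compact (g ` {0..1})" by (intro compact_continuous_image g) simp
    then have cl: "closed (g ` {0..1})" by (rule compact_imp_closed)
    have "y \<in> closure (g ` {0..1})" if y: "y \<in> D" for y
      unfolding closure_approachable
    proof (intro allI impI)
      fix e :: real assume e: "0 < e"
      then have e2: "0 < e / 2" by simp
      from unif[OF e2] obtain n0 where n0: "\<And>n x. n0 \<le> n \<Longrightarrow> x \<in> {0..1} \<Longrightarrow> norm (\<sigma> (r n) x - g x) < e / 2" by blast
      have "\<forall>\<^sub>F n in sequentially. \<exists>i\<le>N (r n). dist y (p (r n) i) < e / 2"
        using eventually_subseq[OF r cov[OF y e2]] .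
      then obtain n where n: "n0 \<le> n" "\<exists>i\<le>N (r n). dist y (p (r n) i) < e / 2"
        unfolding eventually_at_top_linorder by (meson max.cobounded1 max.cobounded2)
      then obtain i where i: "i \<le> N (r n)" "dist y (p (r n) i) < e / 2" by blast
      define x where "x = i / N (r n)"
      have x: "x \<in> {0..1}" unfolding x_def by (rule node[OF i(1)])
      have "dist (g x) y \<le> dist (g x) (\<sigma> (r n) x) + dist (\<sigma> (r n) x) y" by (rule dist_triangle)
      also have "\<dots> < e / 2 + e / 2"
        using n0[OF n(1) x] i(2) by (intro add_strict_mono) (simp_all add: x_def \<sigma>_node dist_commute dist_norm norm_minus_commute)
      finally show "\<exists>z\<in>g ` {0..1}. dist z y < e" using x by auto
    qed
    then have "D \<subseteq> g ` {0..1}" using cl by (auto simp: closure_closed)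
    then have "closure D \<subseteq> g ` {0..1}" using cl by (rule closure_minimal)
    then show ?thesis using dense by blast
  qed
  ultimately have "(\<forall>s\<in>{0..1}. g s = \<gamma> s) \<or> (\<forall>s\<in>{0..1}. g s = \<gamma> (1 - s))"
    by (rule lipschitz_cover_rigid[OF par])
  moreover have "g 0 \<bullet> b \<le> g 1 \<bullet> b"
  proof (rule LIMSEQ_le)
    show "(\<lambda>n. \<sigma> (r n) 0 \<bullet> b) \<longlonglongrightarrow> g 0 \<bullet> b" by (intro tendsto_inner lim tendsto_const) simp
    show "(\<lambda>n. \<sigma> (r n) 1 \<bullet> b) \<longlonglongrightarrow> g 1 \<bullet> b" by (intro tendsto_inner lim tendsto_const) simp
    have "\<sigma> (r n) 0 \<bullet> b \<le> \<sigma> (r n) 1 \<bullet> b" for n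
      using dir(1)[of "r n"] \<sigma>_node[of "r n" 0] \<sigma>_node[of "r n" "N (r n)"] N[of "r n"] by simp
    then show "\<exists>n0. \<forall>n\<ge>n0. \<sigma> (r n) 0 \<bullet> b \<le> \<sigma> (r n) 1 \<bullet> b" by blast
  qed
  ultimately have g\<gamma>: "g s = \<gamma> s" if "s \<in> {0..1}" for s
    using dir(2) that by force
  from unif[OF e] obtain n where n: "\<And>x. x \<in> {0..1} \<Longrightarrow> norm (\<sigma> (r n) x - g x) < e" by blast
  have "dist (p (r n) i) (\<gamma> (i / N (r n))) < e" if "i \<le> N (r n)" for i
    using n[OF node[OF that]] g\<gamma>[OF node[OF that]] by (simp add: \<sigma>_node dist_norm)
  then show ?thesis by blast
qed

subsection \<open>Recursive functions with oracles\<close>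

text \<open>
  An environment \<open>e\<close> is a total function of which a program sees the first \<open>k\<close> values. Binding one more
  variable shifts it, so that the closure rules below apply by higher-order pattern unification. The
  oracle list is \<open>[g, h]\<close> with \<open>g\<close> for the time \<open>t\<close> and \<open>h\<close> for the length \<open>l\<close>.
\<close>

definition Rec :: "nat \<Rightarrow> ((nat \<Rightarrow> nat) list \<Rightarrow> (nat \<Rightarrow> nat) \<Rightarrow> nat) \<Rightarrow> bool" where
  "Rec k F \<longleftrightarrow> (\<exists>p. \<forall>os e. length os = 2 \<longrightarrow> reval os p (map e [0..<k]) (F os e))"

lemma map_upt_Suc_env: "map e [0..<Suc k] = e 0 # map (\<lambda>i. e (Suc i)) [0..<k]"
  by (simp add: upt_conv_Cons map_Suc_upt[symmetric] comp_def del: upt_Suc)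

lemma reval_Pj_map_upt: "i < k \<Longrightarrow> reval os (Pj i) (map e [0..<k]) (e i)"
  using reval.proj[of i "map e [0..<k]" os] by simp

lemma Rec_var [intro]: "i < k \<Longrightarrow> Rec k (\<lambda>os e. e i)"
  unfolding Rec_def using reval_Pj_map_upt by blast

lemma Rec_comp:
  assumes F: "Rec m F" and G: "\<And>i. i < m \<Longrightarrow> Rec k (G i)"
  shows "Rec k (\<lambda>os e. F os (\<lambda>i. G i os e))"
proof -
  obtain p where p: "\<And>os e. length os = 2 \<Longrightarrow> reval os p (map e [0..<m]) (F os e)"
    using F unfolding Rec_def by blast
  have "\<forall>i. \<exists>q. i < m \<longrightarrow> (\<forall>os e. length os = 2 \<longrightarrow> reval os q (map e [0..<k]) (G i os e))"
    using G unfolding Rec_def by blast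
  then obtain q where q: "\<And>i os e. i < m \<Longrightarrow> length os = 2 \<Longrightarrow> reval os (q i) (map e [0..<k]) (G i os e)"
    by metis
  show ?thesis unfolding Rec_def
  proof (intro exI allI impI)
    fix os :: "(nat \<Rightarrow> nat) list" and e :: "nat \<Rightarrow> nat" assume os: "length os = 2"
    show "reval os (Cn p (map q [0..<m])) (map e [0..<k]) (F os (\<lambda>i. G i os e))"
      by (rule reval.comp[of _ _ _ "map (\<lambda>i. G i os e) [0..<m]"])
         (use os q p[of os "\<lambda>i. G i os e"] in \<open>auto simp: list_all2_map1 list_all2_map2 list_all2_same\<close>)
  qed
qed

lemma Rec_comp1:
  assumes "Rec 1 (\<lambda>os e. f os (e 0))" "Rec k A"
  shows "Rec k (\<lambda>os e. f os (A os e))"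
  using Rec_comp[OF assms(1), of k "\<lambda>_. A"] assms(2) by simp

lemma Rec_comp2:
  assumes "Rec 2 (\<lambda>os e. f os (e 0) (e 1))" "Rec k A" "Rec k B"
  shows "Rec k (\<lambda>os e. f os (A os e) (B os e))"
  using Rec_comp[OF assms(1), of k "\<lambda>i. if i = 0 then A else B"] assms(2,3) by simp

lemma Rec_zero: "Rec k (\<lambda>os e. 0)"
  unfolding Rec_def using reval.zero by blast

lemma Rec_Suc [intro]:
  assumes "Rec k A"
  shows "Rec k (\<lambda>os e. Suc (A os e))"
proof -
  have "Rec 1 (\<lambda>os e. Suc (e 0))"
    unfolding Rec_def by (rule exI[of _ Sc]) (simp add: reval.succ)
  from Rec_comp1[OF this assms] show ?thesis .
qed

lemma Rec_const [intro]: "Rec k (\<lambda>os e. n)"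
  by (induction n) (auto intro: Rec_zero)

lemma Rec_oracle [intro]:
  assumes "i < 2" "Rec k A"
  shows "Rec k (\<lambda>os e. (os ! i) (A os e))"
proof -
  have "Rec 1 (\<lambda>os e. (os ! i) (e 0))"
    unfolding Rec_def using assms(1) by (intro exI[of _ "Orc i"]) (simp add: reval.orc)
  from Rec_comp1[OF this assms(2)] show ?thesis .
qed

text \<open>In a step, \<open>Pr\<close> puts the counter and the previous value before the
  arguments, so the outer variables of \<open>G\<close> move by two places. The recursion is first
  built with its bound as variable 0, for which \<open>N\<close> is then substituted.\<close>

lemma Rec_rec_nat [intro]:
  assumes F: "Rec k F"
    and G: "Rec (Suc (Suc k)) (\<lambda>os e. G os (e 0) (e (Suc 0)) (\<lambda>i. e (Suc (Suc i))))"
    and N: "Rec k N"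
  shows "Rec k (\<lambda>os e. rec_nat (F os e) (\<lambda>n y. G os n y e) (N os e))"
proof -
  obtain f where f: "\<And>os e. length os = 2 \<Longrightarrow> reval os f (map e [0..<k]) (F os e)"
    using F unfolding Rec_def by blast
  obtain g where g: "\<And>os e. length os = 2 \<Longrightarrow> reval os g (map e [0..<Suc (Suc k)])
      (G os (e 0) (e (Suc 0)) (\<lambda>i. e (Suc (Suc i))))"
    using G unfolding Rec_def by blast
  have pr: "reval os (Pr f g) (n # map e [0..<k]) (rec_nat (F os e) (\<lambda>n y. G os n y e) n)"
    if os: "length os = 2" for os e n
  proof (induction n)
    case 0
    show ?case using reval.prim0[OF f[OF os]] by simp
  next
    case (Suc n)
    let ?y = "rec_nat (F os e) (\<lambda>n y. G os n y e) n"
    show ?case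
      using reval.primS[OF Suc, of _] g[OF os, of "case_nat n (case_nat ?y e)"]
      by (simp add: map_upt_Suc_env del: upt_Suc)
  qed
  have "Rec (Suc k) (\<lambda>os e. rec_nat (F os (\<lambda>i. e (Suc i))) (\<lambda>n y. G os n y (\<lambda>i. e (Suc i))) (e 0))"
    unfolding Rec_def by (rule exI[of _ "Pr f g"]) (auto simp: map_upt_Suc_env pr simp del: upt_Suc)
  moreover have "Rec k (case_nat N (\<lambda>i os e. e i) i)" if "i < Suc k" for i
    using that N by (cases i) auto
  ultimately show ?thesis using Rec_comp[of "Suc k" _ k "case_nat N (\<lambda>i os e. e i)"] by fastforce
qed

lemma Rec_add [intro]:
  assumes "Rec k A" "Rec k B"
  shows "Rec k (\<lambda>os e. A os e + B os e)"
proof -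
  have "rec_nat a (\<lambda>n y. Suc y) b = a + b" for a b :: nat by (induction b) auto
  moreover have "Rec k (\<lambda>os e. rec_nat (A os e) (\<lambda>n y. Suc y) (B os e))"
    by (intro Rec_rec_nat assms Rec_Suc Rec_var) simp
  ultimately show ?thesis by simp
qed

lemma Rec_mult [intro]:
  assumes "Rec k A" "Rec k B"
  shows "Rec k (\<lambda>os e. A os e * B os e)"
proof -
  have *: "rec_nat 0 (\<lambda>n y. y + a) b = a * b" for a b :: nat by (induction b) auto
  have "Rec 2 (\<lambda>os e. rec_nat 0 (\<lambda>n y. y + e 0) (e 1))" by (intro Rec_rec_nat Rec_add Rec_const Rec_var) auto
  from Rec_comp2[OF this[unfolded *] assms] show ?thesis .
qed

lemma Rec_power [intro]:
  assumes "Rec k A" "Rec k B"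
  shows "Rec k (\<lambda>os e. A os e ^ B os e)"
proof -
  have *: "rec_nat 1 (\<lambda>n y. y * a) b = a ^ b" for a b :: nat by (induction b) auto
  have "Rec 2 (\<lambda>os e. rec_nat 1 (\<lambda>n y. y * e 0) (e 1))" by (intro Rec_rec_nat Rec_mult Rec_const Rec_var) auto
  from Rec_comp2[OF this[unfolded *] assms] show ?thesis .
qed

lemma Rec_diff [intro]:
  assumes "Rec k A" "Rec k B"
  shows "Rec k (\<lambda>os e. A os e - B os e)"
proof -
  have **: "rec_nat 0 (\<lambda>n y. n) a = a - 1" for a :: nat by (cases a) auto
  have p: "Rec 1 (\<lambda>os e. rec_nat 0 (\<lambda>n y. n) (e 0))" by (intro Rec_rec_nat Rec_const Rec_var) auto
  have *: "rec_nat a (\<lambda>n y. y - 1) b = a - b" for a b :: nat by (induction b) auto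
  have "Rec 2 (\<lambda>os e. rec_nat (e 0) (\<lambda>n y. y - 1) (e 1))"
    by (intro Rec_rec_nat Rec_comp1[OF p[unfolded **]] Rec_var) auto
  from Rec_comp2[OF this[unfolded *] assms] show ?thesis .
qed

lemma Rec_sum [intro]:
  assumes "Rec k N" "Rec (Suc k) (\<lambda>os e. G os (e 0) (\<lambda>i. e (Suc i)))"
  shows "Rec k (\<lambda>os e. \<Sum>i<N os e. G os i e)"
proof -
  have *: "rec_nat 0 (\<lambda>n y. y + g n) m = (\<Sum>i<m. g i)" for g and m :: nat by (induction m) auto
  \<comment> \<open>The summand must skip the accumulator, which is variable 1; the other variables
    are renumbered around it.\<close>
  have "Rec (Suc (Suc k)) (\<lambda>os e. G os (e 0) (\<lambda>i. e (Suc (Suc i))))"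
  proof -
    have "Rec (Suc (Suc k)) (\<lambda>os e. case i of 0 \<Rightarrow> e 0 | Suc i \<Rightarrow> e (Suc (Suc i)))" if "i < Suc k" for i
      using that by (cases i) auto
    from Rec_comp[OF assms(2), of "Suc (Suc k)" "\<lambda>i os e. case i of 0 \<Rightarrow> e 0 | Suc i \<Rightarrow> e (Suc (Suc i))", OF this]
    show ?thesis by simp
  qed
  then have "Rec k (\<lambda>os e. rec_nat 0 (\<lambda>n y. y + G os n e) (N os e))"
    by (intro Rec_rec_nat Rec_add Rec_const Rec_var assms) simp
  then show ?thesis by (simp add: *)
qed

section \<open>Decidable predicates, bounded quantifiers, division and pairing\<close>

abbreviation RecP :: "nat \<Rightarrow> ((nat \<Rightarrow> nat) list \<Rightarrow> (nat \<Rightarrow> nat) \<Rightarrow> bool) \<Rightarrow> bool" where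
  "RecP k P \<equiv> Rec k (\<lambda>os e. of_bool (P os e))"

lemma Rec_le [intro]:
  assumes "Rec k A" "Rec k B"
  shows "RecP k (\<lambda>os e. A os e \<le> B os e)"
proof -
  have *: "of_bool (a \<le> b) = 1 - (a - b)" for a b :: nat by auto
  show ?thesis unfolding * by (intro Rec_diff assms Rec_const)
qed

lemma Rec_not [intro]:
  assumes "RecP k P"
  shows "RecP k (\<lambda>os e. \<not> P os e)"
proof -
  have *: "of_bool (\<not> p) = 1 - (of_bool p :: nat)" for p by auto
  show ?thesis unfolding * by (intro Rec_diff assms Rec_const)
qed

lemma Rec_conj [intro]:
  assumes "RecP k P" "RecP k Q"
  shows "RecP k (\<lambda>os e. P os e \<and> Q os e)"
  unfolding of_bool_conj by (intro Rec_mult assms)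

lemma Rec_imp [intro]:
  assumes "RecP k P" "RecP k Q"
  shows "RecP k (\<lambda>os e. P os e \<longrightarrow> Q os e)"
proof -
  have *: "(p \<longrightarrow> q) = (\<not> (p \<and> \<not> q))" for p q by auto
  show ?thesis unfolding * by (intro Rec_not Rec_conj assms)
qed

lemma Rec_eq [intro]:
  assumes "Rec k A" "Rec k B"
  shows "RecP k (\<lambda>os e. A os e = B os e)"
  unfolding order_eq_iff by (intro Rec_conj Rec_le assms)

lemma Rec_if [intro]:
  assumes "RecP k P" "Rec k A" "Rec k B"
  shows "Rec k (\<lambda>os e. if P os e then A os e else B os e)"
proof -
  have *: "(if p then a else b) = of_bool p * a + of_bool (\<not> p) * b" for p and a b :: nat by auto
  show ?thesis unfolding * by (intro Rec_add Rec_mult Rec_not assms)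
qed

lemma Rec_ex [intro]:
  assumes "Rec k N" "RecP (Suc k) (\<lambda>os e. G os (e 0) (\<lambda>i. e (Suc i)))"
  shows "RecP k (\<lambda>os e. \<exists>i<N os e. G os i e)"
proof -
  have *: "(\<exists>i<n. g i) \<longleftrightarrow> \<not> (\<Sum>i<n. of_bool (g i)) = (0::nat)" for g and n :: nat by auto
  show ?thesis unfolding * by (intro Rec_not Rec_eq Rec_sum Rec_const assms)
qed

lemma Rec_all [intro]:
  assumes "Rec k N" "RecP (Suc k) (\<lambda>os e. G os (e 0) (\<lambda>i. e (Suc i)))"
  shows "RecP k (\<lambda>os e. \<forall>i<N os e. G os i e)"
proof -
  have *: "(\<forall>i<n. g i) \<longleftrightarrow> \<not> (\<exists>i<n. \<not> g i)" for g and n :: nat by auto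
  show ?thesis unfolding * by (intro Rec_not Rec_ex assms)
qed

lemma Rec_div [intro]:
  assumes "Rec k A" "Rec k B"
  shows "Rec k (\<lambda>os e. A os e div B os e)"
proof -
  \<comment> \<open>The quotient counts the positive multiples of \<open>b\<close> up to
    \<open>a\<close>; the guard reproduces \<open>a div 0 = 0\<close>.\<close>
  have *: "(\<Sum>i<a. of_bool (\<not> b = 0 \<and> Suc i * b \<le> a)) = a div b" for a b :: nat
  proof (cases "b = 0")
    case False
    then have "{..<a} \<inter> {i. \<not> b = 0 \<and> Suc i * b \<le> a} = {..<a div b}"
      by (auto simp flip: less_eq_div_iff_mult_less_eq simp del: mult_Suc intro: order.strict_trans2)
    then show ?thesis by (simp add: of_bool_def sum.If_cases)
  qed simp
  have "Rec 2 (\<lambda>os e. \<Sum>i<e 0. of_bool (\<not> e 1 = 0 \<and> Suc i * e 1 \<le> e 0))"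
    by (intro Rec_sum Rec_conj Rec_not Rec_eq Rec_le Rec_mult Rec_Suc Rec_const Rec_var) auto
  from Rec_comp2[OF this[unfolded *] assms] show ?thesis .
qed

lemma Rec_mod [intro]:
  assumes "Rec k A" "Rec k B"
  shows "Rec k (\<lambda>os e. A os e mod B os e)"
  unfolding minus_mult_div_eq_mod[symmetric] by (intro Rec_diff Rec_mult Rec_div assms)

lemma Rec_min [intro]:
  assumes "Rec k A" "Rec k B"
  shows "Rec k (\<lambda>os e. min (A os e) (B os e))"
  unfolding min_def by (intro Rec_if Rec_le assms)

lemma Rec_even [intro]:
  assumes "Rec k A"
  shows "RecP k (\<lambda>os e. even (A os e))"
  unfolding even_iff_mod_2_eq_zero by (intro Rec_eq Rec_mod Rec_const assms)

lemma Rec_prod_encode [intro]: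
  assumes "Rec k A" "Rec k B"
  shows "Rec k (\<lambda>os e. prod_encode (A os e, B os e))"
  unfolding prod_encode_def triangle_def split
  by (intro Rec_add Rec_div Rec_mult Rec_Suc Rec_const assms)

text \<open>Inverts the pairing by bounded search: the components of a pair never exceed its code,
  so the sum selects exactly one term.\<close>

lemma prod_decode_sum:
  fixes f :: "nat \<Rightarrow> nat \<Rightarrow> nat"
  shows "(\<Sum>a<Suc c. \<Sum>b<Suc c. of_bool (prod_encode (a, b) = c) * f a b) = case_prod f (prod_decode c)"
proof -
  obtain x y where xy: "prod_decode c = (x, y)" by fastforce
  then have c: "c = prod_encode (x, y)" by (metis prod_decode_inverse)
  have "x < Suc c" "y < Suc c" unfolding c using le_prod_encode_1 le_prod_encode_2 by (simp_all add: less_Suc_eq_le)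
  have "(\<Sum>a<Suc c. \<Sum>b<Suc c. of_bool (prod_encode (a, b) = c) * f a b)
      = (\<Sum>a<Suc c. \<Sum>b<Suc c. if b = y then (if a = x then f a b else 0) else 0)"
    unfolding c by (intro sum.cong refl) auto
  also have "\<dots> = f x y" using \<open>x < Suc c\<close> \<open>y < Suc c\<close> by (simp only: sum.delta' sum.delta finite_lessThan lessThan_iff if_True)
  finally show ?thesis by (simp add: xy)
qed

lemma Rec_prod_decode_fst [intro]:
  assumes "Rec k A"
  shows "Rec k (\<lambda>os e. fst (prod_decode (A os e)))"
  unfolding fst_def prod_decode_sum[symmetric]
  by (rule Rec_comp1[OF _ assms], intro Rec_sum Rec_mult Rec_eq Rec_prod_encode Rec_Suc Rec_var) auto

lemma Rec_prod_decode_snd [intro]: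
  assumes "Rec k A"
  shows "Rec k (\<lambda>os e. snd (prod_decode (A os e)))"
  unfolding snd_def prod_decode_sum[symmetric]
  by (rule Rec_comp1[OF _ assms], intro Rec_sum Rec_mult Rec_eq Rec_prod_encode Rec_Suc Rec_var) auto

lemma Rec_list_encode:
  assumes "\<And>c. c \<in> set cs \<Longrightarrow> Rec k (F c)"
  shows "Rec k (\<lambda>os e. list_encode (map (\<lambda>c. F c os e) cs))"
  using assms
proof (induction cs)
  case (Cons a cs)
  then have "Rec k (F a)" "Rec k (\<lambda>os e. list_encode (map (\<lambda>c. F c os e) cs))" by simp_all
  then show ?case by (simp add: Rec_Suc Rec_prod_encode)
qed (simp add: Rec_const)

text \<open>Minimization of the decision function for \<open>\<not> P\<close>, followed by
  \<open>F\<close>. The conclusion leaves open which \<open>w\<close> is found, since the algorithm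
  is correct for every accepted one.\<close>

lemma Rec_search:
  assumes P: "RecP (Suc k) (\<lambda>os e. P os (e 0) (\<lambda>i. e (Suc i)))"
    and F: "Rec (Suc k) (\<lambda>os e. F os (e 0) (\<lambda>i. e (Suc i)))"
  shows "\<exists>p. \<forall>os e. length os = 2 \<longrightarrow> (\<exists>w. P os w e) \<longrightarrow>
           (\<exists>w. P os w e \<and> reval os p (map e [0..<k]) (F os w e))"
proof -
  obtain p where p: "\<And>os e. length os = 2 \<Longrightarrow>
      reval os p (map e [0..<Suc k]) (of_bool (\<not> P os (e 0) (\<lambda>i. e (Suc i))))"
    using Rec_not[OF P] unfolding Rec_def by blast
  obtain f where f: "\<And>os e. length os = 2 \<Longrightarrow>
      reval os f (map e [0..<Suc k]) (F os (e 0) (\<lambda>i. e (Suc i)))"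
    using F unfolding Rec_def by blast
  show ?thesis
  proof (intro exI[of _ "Cn f (Mn p # map Pj [0..<k])"] allI impI)
    fix os :: "(nat \<Rightarrow> nat) list" and e :: "nat \<Rightarrow> nat"
    assume os: "length os = 2" and ex: "\<exists>w. P os w e"
    define w where "w = (LEAST w. P os w e)"
    have w: "P os w e" unfolding w_def using ex by (rule LeastI_ex)
    have p': "reval os p (v # map e [0..<k]) (of_bool (\<not> P os v e))" for v
      using p[OF os, of "case_nat v e"] by (simp add: map_upt_Suc_env del: upt_Suc)
    have "reval os (Mn p) (map e [0..<k]) w"
    proof (rule reval.mu)
      show "reval os p (w # map e [0..<k]) 0" using p'[of w] w by simp
      show "\<forall>m<w. \<exists>y. y \<noteq> 0 \<and> reval os p (m # map e [0..<k]) y"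
      proof (intro allI impI)
        fix m assume "m < w"
        then have "\<not> P os m e" unfolding w_def by (rule not_less_Least)
        then show "\<exists>y. y \<noteq> 0 \<and> reval os p (m # map e [0..<k]) y" using p'[of m] by auto
      qed
    qed
    moreover have "list_all2 (\<lambda>g. reval os g (map e [0..<k])) (map Pj [0..<k]) (map e [0..<k])"
      by (auto simp: list_all2_map1 list_all2_map2 list_all2_same reval_Pj_map_upt)
    ultimately have "list_all2 (\<lambda>g. reval os g (map e [0..<k])) (Mn p # map Pj [0..<k]) (w # map e [0..<k])"
      by simp
    moreover have "reval os f (w # map e [0..<k]) (F os w e)"
      using f[OF os, of "case_nat w e"] by (simp add: map_upt_Suc_env del: upt_Suc)
    ultimately have "reval os (Cn f (Mn p # map Pj [0..<k])) (map e [0..<k]) (F os w e)"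
      by (rule reval.comp)
    then show "\<exists>w. P os w e \<and> reval os (Cn f (Mn p # map Pj [0..<k])) (map e [0..<k]) (F os w e)"
      using w by blast
  qed
qed

text \<open>
  To run a machine on an input given by a number instead of an oracle, every oracle call is replaced by
  an extra last argument; \<open>k\<close> is the number of arguments that the program originally receives.
\<close>

primrec const_oracle :: "recf \<Rightarrow> nat \<Rightarrow> recf" where
  "const_oracle Zr k = Zr"
| "const_oracle Sc k = Sc"
| "const_oracle (Pj i) k = Pj i"
| "const_oracle (Cn f gs) k = Cn (const_oracle f (length gs)) (map (\<lambda>g. g k) (map const_oracle gs) @ [Pj k])"
| "const_oracle (Pr f g) k = Pr (const_oracle f (k - 1)) (const_oracle g (Suc k))"
| "const_oracle (Mn f) k = Mn (const_oracle f (Suc k))"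
| "const_oracle (Orc i) k = Pj k"

text \<open>The answer \<open>q\<close> goes at the end so that all projections keep their index.
  Compositions hand it on, and an oracle call, whatever the query, becomes a projection to
  it.\<close>

lemma reval_const_oracle:
  assumes "reval [\<lambda>_. q] p xs c"
  shows "reval os (const_oracle p (length xs)) (xs @ [q]) c"
  using assms
proof (induction rule: reval.induct)
  case (proj i xs)
  then show ?case using reval.proj[of i "xs @ [q]" os] by (simp add: nth_append)
next
  case (comp xs gs ys f z)
  from comp.IH(1) have gs: "list_all2 (\<lambda>g y. reval os (const_oracle g (length xs)) (xs @ [q]) y) gs ys"
    by (rule list_all2_mono) simp
  then have "list_all2 (\<lambda>g. reval os g (xs @ [q])) (map (\<lambda>g. const_oracle g (length xs)) gs) ys"
    by (simp add: list_all2_map1)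
  moreover have "reval os (Pj (length xs)) (xs @ [q]) q"
    using reval.proj[of "length xs" "xs @ [q]" os] by simp
  ultimately have "list_all2 (\<lambda>g. reval os g (xs @ [q]))
      (map (\<lambda>g. const_oracle g (length xs)) gs @ [Pj (length xs)]) (ys @ [q])"
    by (simp add: list_all2_appendI)
  moreover have "reval os (const_oracle f (length gs)) (ys @ [q]) z"
    using comp.IH(2) list_all2_lengthD[OF gs] by simp
  ultimately show ?case using reval.comp by (simp add: comp_def)
next
  case (primS f g n xs y z)
  then show ?case using reval.primS[of os "const_oracle f (length xs)"] by simp
next
  case (mu f n xs)
  from mu.IH(2) have "\<forall>m<n. \<exists>y. y \<noteq> 0 \<and> reval os (const_oracle f (Suc (length xs))) (m # xs @ [q]) y"
    by fastforce
  with mu.IH(1) show ?case using reval.mu by simp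
next
  case (orc i x xs)
  then show ?case using reval.proj[of "Suc (length xs)" "x # xs @ [q]" os] by (simp add: nth_append)
qed (simp_all add: reval.zero reval.succ reval.prim0)

section \<open>Determinism and finite oracle use\<close>

inductive_cases reval_ZrE: "reval os Zr xs c"
inductive_cases reval_ScE: "reval os Sc xs c"
inductive_cases reval_PjE: "reval os (Pj i) xs c"
inductive_cases reval_CnE: "reval os (Cn f gs) xs c"
inductive_cases reval_Pr0E: "reval os (Pr f g) (0 # xs) c"
inductive_cases reval_PrSucE: "reval os (Pr f g) (Suc n # xs) c"
inductive_cases reval_MnE: "reval os (Mn f) xs c"
inductive_cases reval_OrcE: "reval os (Orc i) xs c"

text \<open>Serves to identify the answers at two nearby inputs whose oracles look alike to the
  machine. For \<open>Mn\<close>, a smaller result in either run would be a zero where the other run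
  has a nonzero value.\<close>

lemma reval_deterministic:
  assumes "reval os p xs c" "reval os p xs c'"
  shows "c' = c"
  using assms
proof (induction arbitrary: c' rule: reval.induct)
  case (zero xs)
  from zero.prems show ?case by (rule reval_ZrE)
next
  case (succ x xs)
  from succ.prems show ?case by (rule reval_ScE) simp
next
  case (proj i xs)
  from proj.prems show ?case by (rule reval_PjE)
next
  case (comp xs gs ys f z)
  from comp.prems obtain ys' where ys': "list_all2 (\<lambda>g. reval os g xs) gs ys'" "reval os f ys' c'"
    by (rule reval_CnE)
  have "ys' ! i = ys ! i" if "i < length gs" for i
    using list_all2_nthD[OF comp.IH(1) that] list_all2_nthD[OF ys'(1) that] by blast
  then have "ys' = ys"
    using list_all2_lengthD[OF comp.IH(1)] list_all2_lengthD[OF ys'(1)] by (intro nth_equalityI) auto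
  then show ?case using ys'(2) comp.IH(2) by simp
next
  case (prim0 f xs y g)
  from prim0.prems prim0.IH show ?case by (blast elim: reval_Pr0E)
next
  case (primS f g n xs y z)
  from primS.prems obtain y' where y': "reval os (Pr f g) (n # xs) y'" "reval os g (n # y' # xs) c'"
    by (rule reval_PrSucE)
  then have "y' = y" using primS.IH(1) by blast
  then show ?case using y'(2) primS.IH(2) by blast
next
  case (mu f n xs)
  from mu.prems have c': "reval os f (c' # xs) 0" "\<forall>m<c'. \<exists>y. y \<noteq> 0 \<and> reval os f (m # xs) y"
    by (rule reval_MnE, blast)+
  have "\<not> c' < n"
  proof
    assume "c' < n"
    with mu.IH(2) obtain y where "y \<noteq> 0" "\<forall>c. reval os f (c' # xs) c \<longrightarrow> c = y" by blast
    with c'(1) show False by blast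
  qed
  moreover have "\<not> n < c'"
  proof
    assume "n < c'"
    with c'(2) obtain y where "y \<noteq> 0" "reval os f (n # xs) y" by blast
    with mu.IH(1)[of y] show False by simp
  qed
  ultimately show ?case by simp
next
  case (orc k x xs)
  from orc.prems show ?case by (rule reval_OrcE) simp
qed

text \<open>A derivation is finite, so it contains only finitely many oracle queries.\<close>

lemma reval_use:
  assumes "reval [g] p xs c"
  shows "\<exists>U. \<forall>g'. (\<forall>s<U. g' s = g s) \<longrightarrow> reval [g'] p xs c"
proof -
  define agree where "agree g' U \<longleftrightarrow> (\<forall>s<U. g' s = g s)" for g' and U :: nat
  \<comment> \<open>Phrased with \<open>eventually\<close>, the bounds of finitely many
    subcomputations combine without explicit maxima.\<close>
  have "eventually (\<lambda>U. \<forall>g'. agree g' U \<longrightarrow> reval [g'] p xs c) sequentially"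
    using assms
  proof (induction rule: reval.induct)
    case (comp xs gs ys f z)
    have len: "length gs = length ys" using comp.IH(1) by (rule list_all2_lengthD)
    have "eventually (\<lambda>U. \<forall>i\<in>{..<length gs}. \<forall>g'. agree g' U \<longrightarrow> reval [g'] (gs ! i) xs (ys ! i)) sequentially"
    proof (rule eventually_ball_finite, simp, rule ballI)
      fix i assume "i \<in> {..<length gs}"
      then have "i < length gs" by simp
      from list_all2_nthD[OF comp.IH(1) this]
      show "eventually (\<lambda>U. \<forall>g'. agree g' U \<longrightarrow> reval [g'] (gs ! i) xs (ys ! i)) sequentially" by blast
    qed
    then show ?case using comp.IH(2)
    proof eventually_elim
      case (elim U)
      show ?case
      proof (intro allI impI)
        fix g' assume "agree g' U"
        then have "list_all2 (\<lambda>h. reval [g'] h xs) gs ys" "reval [g'] f ys z"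
          using elim len by (simp_all add: list_all2_conv_all_nth)
        then show "reval [g'] (Cn f gs) xs z" by (rule reval.comp)
      qed
    qed
  next
    case (mu f n xs)
    have "\<exists>y. \<forall>m. m < n \<longrightarrow> y m \<noteq> 0 \<and>
      eventually (\<lambda>U. \<forall>g'. agree g' U \<longrightarrow> reval [g'] f (m # xs) (y m)) sequentially"
      by (rule choice) (use mu.IH(2) in blast)
    then obtain y where y: "\<And>m. m < n \<Longrightarrow> y m \<noteq> 0"
      "\<And>m. m < n \<Longrightarrow> eventually (\<lambda>U. \<forall>g'. agree g' U \<longrightarrow> reval [g'] f (m # xs) (y m)) sequentially" by blast
    have "eventually (\<lambda>U. \<forall>m\<in>{..<n}. \<forall>g'. agree g' U \<longrightarrow> reval [g'] f (m # xs) (y m)) sequentially"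
      by (rule eventually_ball_finite) (simp_all add: y)
    then show ?case using mu.IH(1)
    proof eventually_elim
      case (elim U)
      show ?case
      proof (intro allI impI)
        fix g' assume a: "agree g' U"
        show "reval [g'] (Mn f) xs n"
          by (rule reval.mu) (use a elim y(1) in blast)+
      qed
    qed
  next
    case (orc i x xs)
    show ?case using eventually_gt_at_top[of x]
    proof eventually_elim
      case (elim U)
      show ?case
      proof (intro allI impI)
        fix g' assume "agree g' U"
        then have "g' x = g x" using elim by (simp add: agree_def)
        then show "reval [g'] (Orc i) (x # xs) (([g] ! i) x)"
          using orc reval.orc[of i "[g']" x xs] by simp
      qed
    qed
  next
    case (primS f h n xs y z)
    from primS.IH show ?case
    proof eventually_elim
      case (elim U)
      show ?case
      proof (intro allI impI)
        fix g' assume "agree g' U"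
        then have "reval [g'] (Pr f h) (n # xs) y" "reval [g'] h (n # y # xs) z" using elim by simp_all
        then show "reval [g'] (Pr f h) (Suc n # xs) z" by (rule reval.primS)
      qed
    qed
  next
    case (prim0 f xs y h)
    from prim0.IH show ?case by eventually_elim (simp add: reval.prim0)
  qed (simp_all add: reval.zero reval.succ reval.proj)
  then show ?thesis unfolding agree_def eventually_at_top_linorder by blast
qed

subsection \<open>Codes of rationals and points\<close>

definition digit :: "nat \<Rightarrow> nat \<Rightarrow> nat \<Rightarrow> nat" where
  "digit b P k = P div b ^ k mod b"

lemma ex_digits:
  assumes "\<And>k. k < m \<Longrightarrow> f k < b"
  shows "\<exists>P<b ^ m. \<forall>k<m. digit b P k = f k"
  using assms
proof (induction m)
  case (Suc m)
  then obtain P where P: "P < b ^ m" "\<And>k. k < m \<Longrightarrow> digit b P k = f k" by fastforce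
  let ?Q = "f m * b ^ m + P"
  have fm: "f m < b" using Suc.prems by simp
  have "?Q < Suc (f m) * b ^ m" using P(1) by simp
  also have "\<dots> \<le> b ^ Suc m" using fm by (simp add: Suc_leI mult_le_mono1 del: mult_Suc)
  finally have "?Q < b ^ Suc m" .
  moreover have "digit b ?Q k = f k" if "k < Suc m" for k
  proof (cases "k = m")
    case True
    then show ?thesis using P(1) fm by (simp add: digit_def)
  next
    case False
    then have k: "k < m" using that by simp
    \<comment> \<open>The new leading digit contributes a multiple of \<open>b ^ Suc k\<close>,
      which digit \<open>k\<close> does not see.\<close>
    then have "b ^ m = b ^ k * (b * b ^ (m - Suc k))"
      by (metis Suc_diff_Suc add_diff_inverse_nat not_less_iff_gr_or_eq power_Suc power_add)
    then have Q: "?Q = P + b ^ k * (b * (b ^ (m - Suc k) * f m))" by (simp add: ac_simps)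
    have "0 < b" using fm by simp
    then have "?Q div b ^ k mod b = P div b ^ k mod b" unfolding Q by simp
    then show ?thesis using P(2)[OF k] by (simp add: digit_def)
  qed
  ultimately show ?case by blast
qed simp

definition adiff :: "nat \<Rightarrow> nat \<Rightarrow> nat" where
  "adiff a b = (a - b) + (b - a)"

lemma real_adiff [simp]: "real (adiff a b) = \<bar>real a - real b\<bar>"
  by (auto simp: adiff_def of_nat_diff abs_if not_less)

text \<open>Up to rounding, \<open>max 0 (q + R) * 2 ^ s\<close> for the rational \<open>q\<close>
  coded by \<open>z\<close>. The parity test is for the sign: \<open>int_decode\<close> takes odd
  numbers to the negative integers. Truncated subtraction produces the maximum with 0.\<close>

definition scaled_code :: "nat \<Rightarrow> nat \<Rightarrow> nat \<Rightarrow> nat" where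
  "scaled_code R s z =
     (if even (fst (prod_decode z))
      then R * 2 ^ s + (fst (prod_decode z) div 2) * 2 ^ s div Suc (snd (prod_decode z))
      else R * 2 ^ s - Suc (fst (prod_decode z) div 2) * 2 ^ s div Suc (snd (prod_decode z)))"

text \<open>The only error is that of one integer division, and cutting off at 0 does not increase
  it.\<close>

lemma scaled_code:
  "\<bar>real (scaled_code R s z) - max 0 (real_of_rat (rat_of_code z) + R) * 2 ^ s\<bar> \<le> 1"
proof -
  obtain a b where z: "prod_decode z = (a, b)" by fastforce
  have fl: "real (x div Suc b) \<le> real x / real (Suc b)" "real x / real (Suc b) \<le> real (x div Suc b) + 1" for x
  proof -
    have x: "real x = real (x div Suc b) * real (Suc b) + real (x mod Suc b)"
      by (metis div_mult_mod_eq of_nat_add of_nat_mult)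
    have m: "real (x mod Suc b) < real (Suc b)" by (simp del: of_nat_Suc)
    show "real (x div Suc b) \<le> real x / real (Suc b)"
      by (subst pos_le_divide_eq) (use x in simp_all)
    show "real x / real (Suc b) \<le> real (x div Suc b) + 1"
      by (subst pos_divide_le_eq) (use x m in \<open>simp_all add: distrib_right del: of_nat_Suc\<close>)
  qed
  show ?thesis
  proof (cases "even a")
    case True
    let ?m = "a div 2"
    have "int_decode a = int ?m" using True by (simp add: int_decode_def sum_decode_def)
    then have q: "real_of_rat (rat_of_code z) = real ?m / real (Suc b)"
      by (simp add: rat_of_code_def z of_rat_divide of_rat_add)
    have "real (scaled_code R s z) = R * 2 ^ s + real (?m * 2 ^ s div Suc b)"
      using True by (simp add: scaled_code_def z)
    moreover have "max 0 (real_of_rat (rat_of_code z) + R) * 2 ^ s = R * 2 ^ s + real (?m * 2 ^ s) / real (Suc b)"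
      unfolding q by (subst max_absorb2) (simp_all add: algebra_simps del: of_nat_Suc)
    ultimately show ?thesis using fl[of "?m * 2 ^ s"] by linarith
  next
    case False
    define m where "m = Suc (a div 2)"
    have "int_decode a = - int m" using False by (simp add: m_def int_decode_def sum_decode_def)
    then have q: "real_of_rat (rat_of_code z) = - real m / real (Suc b)"
      by (simp add: rat_of_code_def z of_rat_divide of_rat_add of_rat_minus of_rat_diff)
    have sc: "scaled_code R s z = R * 2 ^ s - m * 2 ^ s div Suc b"
      using False by (simp add: scaled_code_def z m_def)
    have eq: "(real_of_rat (rat_of_code z) + R) * 2 ^ s = R * 2 ^ s - real (m * 2 ^ s) / real (Suc b)"
      unfolding q by (simp add: algebra_simps del: of_nat_Suc)
    have mx: "max 0 (real_of_rat (rat_of_code z) + R) * 2 ^ s = max 0 (R * 2 ^ s - real (m * 2 ^ s) / real (Suc b))"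
      unfolding eq[symmetric] by (simp add: max_mult_distrib_right)
    have "real (scaled_code R s z) = max 0 (real (R * 2 ^ s) - real (m * 2 ^ s div Suc b))"
      unfolding sc by (cases "R * 2 ^ s \<le> m * 2 ^ s div Suc b") (simp_all add: of_nat_diff max_def del: of_nat_mult of_nat_power mult_Suc)
    then show ?thesis unfolding mx using fl[of "m * 2 ^ s"] by (simp del: mult_Suc of_nat_Suc)
  qed
qed

text \<open>Undoes one layer \<open>Suc (prod_encode (a, b))\<close> of \<open>list_encode\<close>.
  On the code 0 of the empty list, \<open>0 - 1 = 0\<close> decodes to \<open>(0, 0)\<close>, so the
  empty list is its own tail.\<close>

definition code_tl :: "nat \<Rightarrow> nat" where "code_tl x = snd (prod_decode (x - 1))"
definition code_nth :: "nat \<Rightarrow> nat \<Rightarrow> nat" where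
  "code_nth x j = fst (prod_decode (rec_nat x (\<lambda>_. code_tl) j - 1))"

lemma prod_decode_0: "prod_decode 0 = (0, 0)"
  by (simp add: prod_decode_def prod_decode_aux.simps)

lemma list_decode_code_tl: "list_decode (code_tl x) = tl (list_decode x)"
  by (cases x) (auto simp: code_tl_def prod_decode_0 split: prod.splits)

text \<open>Entries beyond the end of the list come out as 0, which is also a code of the rational 0.\<close>

lemma code_nth:
  "code_nth x j = (if j < length (list_decode x) then list_decode x ! j else 0)"
proof -
  have "list_decode (rec_nat x (\<lambda>_. code_tl) j) = drop j (list_decode x)" for j
    by (induction j) (simp_all add: list_decode_code_tl drop_Suc drop_tl)
  then have drop: "list_decode (rec_nat x (\<lambda>_. code_tl) j) = drop j (list_decode x)" .
  have "fst (prod_decode (y - 1)) = (case list_decode y of [] \<Rightarrow> 0 | a # _ \<Rightarrow> a)" for y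
    by (cases y) (auto simp: prod_decode_0 split: prod.splits)
  then have "code_nth x j = (case drop j (list_decode x) of [] \<Rightarrow> 0 | a # _ \<Rightarrow> a)"
    by (simp add: code_nth_def drop)
  also have "\<dots> = (if j < length (list_decode x) then list_decode x ! j else 0)"
    by (cases "j < length (list_decode x)") (simp_all flip: Cons_nth_drop_Suc)
  finally show ?thesis .
qed

lemma rat_of_code_0: "rat_of_code 0 = 0"
  by (simp add: rat_of_code_def prod_decode_0 int_decode_def sum_decode_def)

section \<open>Coordinates addressed by their position in \<open>coord_enum\<close>\<close>

lemma coord_enum: "distinct (coord_enum :: 'n::finite list)" "set (coord_enum :: 'n list) = UNIV"
proof -
  have "\<exists>xs. distinct xs \<and> set xs = (UNIV :: 'n set)" using finite_distinct_list[of "UNIV :: 'n set"] by auto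
  then have "distinct (coord_enum :: 'n list) \<and> set (coord_enum :: 'n list) = UNIV"
    unfolding coord_enum_def by (rule someI_ex)
  then show "distinct (coord_enum :: 'n::finite list)" "set (coord_enum :: 'n list) = UNIV" by auto
qed

lemma length_coord_enum: "length (coord_enum :: 'n::finite list) = CARD('n)"
  using distinct_card[OF coord_enum(1)[where 'n = 'n]] coord_enum(2)[where 'n = 'n] by simp

lemma point_of_code_nth:
  assumes "c < CARD('n)"
  shows "(point_of_code x :: real ^ 'n::finite) $ (coord_enum ! c) = real_of_rat (rat_of_code (code_nth x c))"
proof -
  let ?ys = "list_decode x"
  have d: "distinct (map fst (zip (coord_enum :: 'n list) ?ys))"
    using coord_enum(1)[where 'n = 'n] by (simp add: map_fst_zip_take)
  have c: "c < length (coord_enum :: 'n list)" using assms by (simp add: length_coord_enum)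
  have "map_of (zip (coord_enum :: 'n list) ?ys) (coord_enum ! c) = (if c < length ?ys then Some (?ys ! c) else None)"
  proof (cases "c < length ?ys")
    case True
    then have "(coord_enum ! c, ?ys ! c) \<in> set (zip (coord_enum :: 'n list) ?ys)"
      using c by (force simp: in_set_zip)
    then show ?thesis using True map_of_is_SomeI[OF d] by simp
  next
    case False
    have "coord_enum ! c \<notin> fst ` set (zip (coord_enum :: 'n list) ?ys)"
    proof
      assume "coord_enum ! c \<in> fst ` set (zip (coord_enum :: 'n list) ?ys)"
      then obtain i where i: "i < length (coord_enum :: 'n list)" "i < length ?ys" "coord_enum ! c = (coord_enum :: 'n list) ! i"
        by (auto simp: in_set_zip)
      then have "i = c" using c coord_enum(1)[where 'n = 'n] by (simp add: nth_eq_iff_index_eq)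
      then show False using i False by simp
    qed
    then show ?thesis using False by (simp add: map_of_eq_None_iff)
  qed
  then show ?thesis by (simp add: point_of_code_def code_nth rat_of_code_0)
qed

definition vec_of :: "(nat \<Rightarrow> real) \<Rightarrow> real ^ 'n::finite" where
  "vec_of f = (\<chi> j. f (SOME c. c < CARD('n) \<and> coord_enum ! c = j))"

lemma vec_of_nth [simp]:
  assumes "c < CARD('n)"
  shows "(vec_of f :: real ^ 'n::finite) $ (coord_enum ! c) = f c"
proof -
  have "(SOME c'. c' < CARD('n) \<and> (coord_enum :: 'n list) ! c' = coord_enum ! c) = c"
    using assms coord_enum(1)[where 'n = 'n]
    by (intro some_equality) (auto simp: length_coord_enum nth_eq_iff_index_eq)
  then show ?thesis by (simp add: vec_of_def)
qed

lemma ex_coord: "\<exists>c<CARD('n). (j :: 'n::finite) = coord_enum ! c"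
  using coord_enum(2)[where 'n = 'n] in_set_conv_nth[of j coord_enum] by (auto simp: length_coord_enum)

lemma sum_coord_enum:
  fixes f :: "'n::finite \<Rightarrow> 'b::comm_monoid_add"
  shows "(\<Sum>j\<in>UNIV. f j) = (\<Sum>c<CARD('n). f (coord_enum ! c))"
proof -
  have "bij_betw ((!) coord_enum) {..<CARD('n)} (UNIV :: 'n set)"
    using bij_betw_nth[OF coord_enum(1)[where 'n = 'n] refl refl] coord_enum(2)[where 'n = 'n]
    by (simp add: length_coord_enum)
  then show ?thesis by (metis sum.reindex_bij_betw)
qed

lemma norm_vec_coord:
  fixes x :: "real ^ 'n::finite"
  shows "(norm x)\<^sup>2 = (\<Sum>c<CARD('n). (x $ (coord_enum ! c))\<^sup>2)"
    and "norm x \<le> (\<Sum>c<CARD('n). \<bar>x $ (coord_enum ! c)\<bar>)"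
proof -
  show "(norm x)\<^sup>2 = (\<Sum>c<CARD('n). (x $ (coord_enum ! c))\<^sup>2)"
    unfolding sum_coord_enum[symmetric, of "\<lambda>j. (x $ j)\<^sup>2"]
    by (simp add: norm_vec_def L2_set_def real_sqrt_pow2 sum_nonneg)
  show "norm x \<le> (\<Sum>c<CARD('n). \<bar>x $ (coord_enum ! c)\<bar>)"
    unfolding sum_coord_enum[symmetric, of "\<lambda>j. \<bar>x $ j\<bar>"] by (rule norm_le_l1_cart)
qed

lemma norm_vec_le_coord:
  fixes x :: "real ^ 'n::finite" and e :: real
  assumes "\<And>c. c < CARD('n) \<Longrightarrow> \<bar>x $ (coord_enum ! c)\<bar> \<le> e"
  shows "norm x \<le> CARD('n) * e"
  using norm_vec_coord(2)[of x] sum_mono[of "{..<CARD('n)}" "\<lambda>c. \<bar>x $ (coord_enum ! c)\<bar>" "\<lambda>_. e"] assms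
  by simp

subsection \<open>Feasible grid polygons\<close>

text \<open>
  At stage \<open>n\<close> the coordinates are measured in units of \<open>4\<^sup>-\<^sup>n\<close> and shifted by \<open>R\<close> to make them natural numbers
  below \<open>2 * R * 4\<^sup>n\<close>. A number \<open>P\<close> encodes all vertices of a polygon through its digits in that base.
\<close>

definition grid :: "nat \<Rightarrow> nat \<Rightarrow> nat \<Rightarrow> nat \<Rightarrow> nat \<Rightarrow> nat \<Rightarrow> nat" where
  "grid d R n P i c = digit (2 * R * 4 ^ n) P (i * d + c)"

text \<open>
  Here \<open>L\<close> approximates \<open>l\<close> in the same units, and \<open>S n j c\<close> is coordinate \<open>c\<close> of the \<open>j\<close>-th sample point. The
  clauses bound the edges and the distances to the sample points, with just enough slack for rounding
  errors. The last one fixes the direction: \<open>{u, v} = {0, 1}\<close>, and \<open>c0\<close> is a coordinate in which the end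
  points of the curve differ.
\<close>

definition feasible ::
    "nat \<Rightarrow> nat \<Rightarrow> nat \<Rightarrow> nat \<Rightarrow> nat \<Rightarrow> (nat \<Rightarrow> nat \<Rightarrow> nat \<Rightarrow> nat) \<Rightarrow> nat \<Rightarrow> nat \<Rightarrow> nat \<Rightarrow> bool" where
  "feasible d R u v c0 S n L P \<longleftrightarrow>
     (\<forall>i<2 ^ n. (\<Sum>c<d. (adiff (grid d R n P (Suc i) c) (grid d R n P i c))\<^sup>2) * (2 ^ n)\<^sup>2 \<le> (L + d * 2 ^ n)\<^sup>2) \<and>
     (\<forall>j<Suc (2 ^ n). \<exists>i<Suc (2 ^ n). \<forall>c<d. adiff (S n j c) (grid d R n P i c) * 2 ^ n \<le> L + 4 * 2 ^ n) \<and>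
     grid d R n P (u * 2 ^ n) c0 \<le> grid d R n P (v * 2 ^ n) c0"

text \<open>Vertex \<open>i\<close> of \<open>Q\<close> is compared with that of every feasible
  polygon; in real units the tolerance per coordinate is \<open>2^-r / (4 * d)\<close>. The bound on
  \<open>P\<close> exhausts all tables of \<open>Suc (2 ^ n) * d\<close> digits, so the test is
  decidable.\<close>

definition settled ::
    "nat \<Rightarrow> nat \<Rightarrow> nat \<Rightarrow> nat \<Rightarrow> nat \<Rightarrow> (nat \<Rightarrow> nat \<Rightarrow> nat \<Rightarrow> nat) \<Rightarrow> nat \<Rightarrow> nat \<Rightarrow> nat \<Rightarrow> nat \<Rightarrow> nat \<Rightarrow> bool" where
  "settled d R u v c0 S n L i Q r \<longleftrightarrow>
     (\<forall>P<(2 * R * 4 ^ n) ^ (Suc (2 ^ n) * d). feasible d R u v c0 S n L P \<longrightarrow>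
        (\<forall>c<d. adiff (grid d R n P i c) (grid d R n Q i c) * (2 ^ r * (4 * d)) \<le> 4 ^ n))"

lemma grid_less:
  assumes "0 < R"
  shows "grid d R n P i c < 2 * R * 4 ^ n"
  using assms by (simp add: grid_def digit_def)

lemma ex_grid:
  assumes "\<And>i c. i < m \<Longrightarrow> c < d \<Longrightarrow> f i c < 2 * R * 4 ^ n"
  shows "\<exists>P<(2 * R * 4 ^ n) ^ (m * d). \<forall>i<m. \<forall>c<d. grid d R n P i c = f i c"
proof -
  have "f (k div d) (k mod d) < 2 * R * 4 ^ n" if "k < m * d" for k
  proof -
    have "0 < d" using that by (cases d) auto
    then show ?thesis using that by (intro assms) (simp_all add: less_mult_imp_div_less)
  qed
  from ex_digits[of "m * d" "\<lambda>k. f (k div d) (k mod d)", OF this] obtain P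
    where P: "P < (2 * R * 4 ^ n) ^ (m * d)"
      "\<And>k. k < m * d \<Longrightarrow> digit (2 * R * 4 ^ n) P k = f (k div d) (k mod d)" by blast
  have "grid d R n P i c = f i c" if "i < m" "c < d" for i c
  proof -
    have "i * d + c < Suc i * d" using that by simp
    also have "\<dots> \<le> m * d" using that by (intro mult_le_mono1) simp
    finally show ?thesis using P(2)[of "i * d + c"] that by (simp add: grid_def)
  qed
  then show ?thesis using P(1) by blast
qed

lemma dyadic_in_unit_interval: "i \<le> 2 ^ n \<Longrightarrow> real i / 2 ^ n \<in> {0..1}" by simp

section \<open>Feasible polygons of a fixed curve\<close>

context
  fixes \<gamma> \<gamma>s :: "real \<Rightarrow> real ^ 'n::finite" and \<Gamma> :: "(real ^ 'n) set" and l :: real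
    and R u v c0 :: nat and S :: "nat \<Rightarrow> nat \<Rightarrow> nat \<Rightarrow> nat"
  assumes par: "normalized_constant_speed_param \<gamma> \<Gamma>" "hausdorff1 \<Gamma> = ennreal l"
    and im: "\<Gamma> = \<gamma>s ` {0..1}"
    and bound: "\<And>x c. x \<in> \<Gamma> \<Longrightarrow> c < CARD('n) \<Longrightarrow> \<bar>x $ (coord_enum ! c)\<bar> < R"
    and sample: "\<And>n j c. j \<le> 2 ^ n \<Longrightarrow> c < CARD('n) \<Longrightarrow>
          \<bar>real (S n j c) - (\<gamma>s (j / 2 ^ n) $ (coord_enum ! c) + R) * 4 ^ n\<bar> \<le> 2"
    and dense: "\<Gamma> \<subseteq> closure {\<gamma>s (real j / 2 ^ n) | j n. j \<le> 2 ^ n}"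
    and c0: "c0 < CARD('n)"
    and uv: "u = 0 \<and> v = 1 \<and> \<gamma> 0 $ (coord_enum ! c0) < \<gamma> 1 $ (coord_enum ! c0) \<or>
             u = 1 \<and> v = 0 \<and> \<gamma> 1 $ (coord_enum ! c0) < \<gamma> 0 $ (coord_enum ! c0)"
begin

definition rounded :: "nat \<Rightarrow> nat \<Rightarrow> nat \<Rightarrow> nat" where
  "rounded n i c = nat \<lfloor>(\<gamma> (i / 2 ^ n) $ (coord_enum ! c) + R) * 4 ^ n\<rfloor>"

lemma \<gamma>_mem: "t \<in> {0..1} \<Longrightarrow> \<gamma> t \<in> \<Gamma>" using param_image[OF par] by blast

lemma rounded:
  assumes "i \<le> 2 ^ n" "c < CARD('n)"
  shows "real (rounded n i c) \<le> (\<gamma> (i / 2 ^ n) $ (coord_enum ! c) + R) * 4 ^ n"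
    and "(\<gamma> (i / 2 ^ n) $ (coord_enum ! c) + R) * 4 ^ n < real (rounded n i c) + 1"
    and "rounded n i c < 2 * R * 4 ^ n"
proof -
  let ?x = "\<gamma> (i / 2 ^ n) $ (coord_enum ! c)"
  have b: "\<bar>?x\<bar> < R" using bound[OF \<gamma>_mem[OF dyadic_in_unit_interval[OF assms(1)]] assms(2)] .
  then have 0: "0 \<le> (?x + R) * 4 ^ n" by simp
  show 1: "real (rounded n i c) \<le> (?x + R) * 4 ^ n"
    unfolding rounded_def using 0 by simp
  show "(?x + R) * 4 ^ n < real (rounded n i c) + 1" unfolding rounded_def using 0 by simp
  have "(?x + R) * 4 ^ n < (2 * real R) * 4 ^ n" using b by (intro mult_strict_right_mono) auto
  from order_le_less_trans[OF 1 this] have "real (rounded n i c) < real (2 * R * 4 ^ n)" by simp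
  then show "rounded n i c < 2 * R * 4 ^ n" by (simp only: of_nat_less_iff)
qed

text \<open>The slack in \<open>feasible\<close> originates here. Rounding down moves a coordinate
  by at most one unit, so an edge vector changes in norm by at most \<open>CARD('n)\<close> units,
  which is then scaled by \<open>2 ^ n\<close>. For the samples, 2 units of sample error and 1 of
  rounding fit into the 4 allowed.\<close>

lemma feasible_rounded:
  assumes L: "l * 4 ^ n \<le> real L"
    and P: "\<And>i c. i \<le> 2 ^ n \<Longrightarrow> c < CARD('n) \<Longrightarrow> grid CARD('n) R n P i c = rounded n i c"
  shows "feasible CARD('n) R u v c0 S n L P"
  unfolding feasible_def
proof (intro conjI allI impI)
  define V :: "nat \<Rightarrow> real ^ 'n" where "V i = vec_of (\<lambda>c. real (rounded n i c))" for i
  define E :: "nat \<Rightarrow> real ^ 'n" where "E i = V i - (4 ^ n *\<^sub>R (\<gamma> (i / 2 ^ n)) + vec_of (\<lambda>c. real R * 4 ^ n))" for i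
  have E: "- 1 \<le> E i $ (coord_enum ! c)" "E i $ (coord_enum ! c) \<le> 0" if "i \<le> 2 ^ n" "c < CARD('n)" for i c
    using rounded(1,2)[OF that] that by (simp_all add: E_def V_def algebra_simps)
  fix i assume i: "i < (2::nat) ^ n"
  have "dist (\<gamma> (Suc i / 2 ^ n)) (\<gamma> (i / 2 ^ n)) \<le> l * dist (Suc i / 2 ^ n) (i / 2 ^ n)"
    by (rule lipschitz_onD[OF param_lipschitz[OF par] dyadic_in_unit_interval dyadic_in_unit_interval]) (use i in auto)
  also have "dist (Suc i / 2 ^ n) (i / 2 ^ n) = 1 / (2::real) ^ n"
    by (simp add: dist_real_def flip: diff_divide_distrib)
  finally have 1: "norm (\<gamma> (Suc i / 2 ^ n) - \<gamma> (i / 2 ^ n)) \<le> l / 2 ^ n" by (simp add: dist_norm)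
  have "norm (E (Suc i) - E i) \<le> real CARD('n) * 1"
    by (rule norm_vec_le_coord) (use E[of i] E[of "Suc i"] i in \<open>fastforce simp: abs_le_iff\<close>)
  moreover have "V (Suc i) - V i = 4 ^ n *\<^sub>R (\<gamma> (Suc i / 2 ^ n) - \<gamma> (i / 2 ^ n)) + (E (Suc i) - E i)"
    by (simp add: E_def algebra_simps)
  ultimately have "norm (V (Suc i) - V i) \<le> 4 ^ n * norm (\<gamma> (Suc i / 2 ^ n) - \<gamma> (i / 2 ^ n)) + CARD('n)"
    using norm_triangle_ineq[of "4 ^ n *\<^sub>R (\<gamma> (Suc i / 2 ^ n) - \<gamma> (i / 2 ^ n))" "E (Suc i) - E i"] by simp
  also have "\<dots> \<le> 4 ^ n * (l / 2 ^ n) + CARD('n)" using mult_left_mono[OF 1, of "4 ^ n"] by simp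
  finally have "norm (V (Suc i) - V i) * 2 ^ n \<le> (4 ^ n * (l / 2 ^ n) + CARD('n)) * 2 ^ n" by (intro mult_right_mono) auto
  also have "\<dots> = l * 4 ^ n + CARD('n) * 2 ^ n" by (simp add: algebra_simps)
  also have "\<dots> \<le> L + CARD('n) * 2 ^ n" using L by simp
  finally have "(norm (V (Suc i) - V i) * 2 ^ n)\<^sup>2 \<le> (real (L + CARD('n) * 2 ^ n))\<^sup>2" by (intro power_mono) auto
  moreover have "(norm (V (Suc i) - V i))\<^sup>2 = (\<Sum>c<CARD('n). (real (adiff (rounded n (Suc i) c) (rounded n i c)))\<^sup>2)"
    unfolding norm_vec_coord(1) by (intro sum.cong) (simp_all add: V_def)
  ultimately have "real ((\<Sum>c<CARD('n). (adiff (rounded n (Suc i) c) (rounded n i c))\<^sup>2) * (2 ^ n)\<^sup>2) \<le> real ((L + CARD('n) * 2 ^ n)\<^sup>2)"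
    by (simp add: power_mult_distrib del: real_adiff)
  then have "(\<Sum>c<CARD('n). (adiff (rounded n (Suc i) c) (rounded n i c))\<^sup>2) * (2 ^ n)\<^sup>2 \<le> (L + CARD('n) * 2 ^ n)\<^sup>2"
    by (simp only: of_nat_le_iff)
  then show "(\<Sum>c<CARD('n). (adiff (grid CARD('n) R n P (Suc i) c) (grid CARD('n) R n P i c))\<^sup>2) * (2 ^ n)\<^sup>2 \<le> (L + CARD('n) * 2 ^ n)\<^sup>2"
    using i by (simp add: P)
next
  have lp: "0 < l" by (rule param_length_pos[OF par])
  fix j assume "j < Suc (2 ^ n)"
  then have j: "j \<le> 2 ^ n" by simp
  have "\<gamma>s (j / 2 ^ n) \<in> \<gamma> ` {0..1}" using dyadic_in_unit_interval[OF j] im param_image[OF par] by blast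
  then obtain \<tau> where \<tau>: "\<tau> \<in> {0..1}" "\<gamma>s (j / 2 ^ n) = \<gamma> \<tau>" by blast
  \<comment> \<open>Going back from \<tau> to the last grid time moves the point by at most
    \<open>l / 2 ^ n\<close>.\<close>
  define i where "i = nat \<lfloor>\<tau> * 2 ^ n\<rfloor>"
  have i: "real i \<le> \<tau> * 2 ^ n" "\<tau> * 2 ^ n < real i + 1" using \<tau>(1) by (simp_all add: i_def)
  have "\<tau> * 2 ^ n \<le> 1 * 2 ^ n" using \<tau>(1) by (intro mult_right_mono) auto
  from order_trans[OF i(1) this] have "real i \<le> real (2 ^ n)" by simp
  then have iN: "i \<le> 2 ^ n" by (simp only: of_nat_le_iff)
  have "\<tau> - i / 2 ^ n = (\<tau> * 2 ^ n - i) / 2 ^ n" by (simp add: diff_divide_distrib)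
  moreover have "0 \<le> (\<tau> * 2 ^ n - i) / 2 ^ n" "(\<tau> * 2 ^ n - i) / 2 ^ n \<le> 1 / 2 ^ n"
    using i by (auto intro: divide_right_mono)
  ultimately have "dist \<tau> (i / 2 ^ n) \<le> 1 / 2 ^ n" by (simp add: dist_real_def)
  then have "dist (\<gamma> \<tau>) (\<gamma> (i / 2 ^ n)) \<le> l * (1 / 2 ^ n)"
    using lipschitz_onD[OF param_lipschitz[OF par] \<tau>(1) dyadic_in_unit_interval[OF iN]] lp
    by (meson mult_left_mono less_imp_le order_trans)
  then have near: "norm (\<gamma> \<tau> - \<gamma> (i / 2 ^ n)) \<le> l / 2 ^ n" by (simp add: dist_norm)
  have "adiff (S n j c) (grid CARD('n) R n P i c) * 2 ^ n \<le> L + 4 * 2 ^ n" if c: "c < CARD('n)" for c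
  proof -
    let ?k = "(coord_enum :: 'n list) ! c"
    have "\<bar>(\<gamma> \<tau> - \<gamma> (i / 2 ^ n)) $ ?k\<bar> \<le> l / 2 ^ n" using component_le_norm_cart near order_trans by blast
    then have "\<bar>\<gamma> \<tau> $ ?k - \<gamma> (i / 2 ^ n) $ ?k\<bar> * 4 ^ n \<le> l / 2 ^ n * 4 ^ n"
      by (intro mult_right_mono) auto
    then have "\<bar>(\<gamma> \<tau> $ ?k + R) * 4 ^ n - (\<gamma> (i / 2 ^ n) $ ?k + R) * 4 ^ n\<bar> \<le> l / 2 ^ n * 4 ^ n"
      by (simp add: abs_mult flip: left_diff_distrib)
    then have "\<bar>real (S n j c) - real (rounded n i c)\<bar> \<le> l / 2 ^ n * 4 ^ n + 4"
      using sample[OF j c] rounded(1,2)[OF iN c] unfolding \<tau>(2) by linarith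
    then have "\<bar>real (S n j c) - real (rounded n i c)\<bar> * 2 ^ n \<le> (l / 2 ^ n * 4 ^ n + 4) * 2 ^ n"
      by (intro mult_right_mono) auto
    also have "\<dots> = l * 4 ^ n + 4 * 2 ^ n" by (simp add: algebra_simps)
    also have "\<dots> \<le> L + 4 * 2 ^ n" using L by simp
    finally have "real (adiff (S n j c) (rounded n i c) * 2 ^ n) \<le> real (L + 4 * 2 ^ n)" by simp
    then show ?thesis using P[OF iN c] by (simp only: of_nat_le_iff)
  qed
  then show "\<exists>i<Suc (2 ^ n). \<forall>c<CARD('n). adiff (S n j c) (grid CARD('n) R n P i c) * 2 ^ n \<le> L + 4 * 2 ^ n"
    using iN by (auto simp: less_Suc_eq_le)
next
  \<comment> \<open>Rounding down is monotone, so the order of the end points survives.\<close>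
  have "rounded n (u * 2 ^ n) c0 \<le> rounded n (v * 2 ^ n) c0"
    unfolding rounded_def using uv by (intro nat_mono floor_mono mult_right_mono) auto
  then show "grid CARD('n) R n P (u * 2 ^ n) c0 \<le> grid CARD('n) R n P (v * 2 ^ n) c0"
    using uv c0 P[of "u * 2 ^ n" c0] P[of "v * 2 ^ n" c0] by auto
qed

definition point :: "nat \<Rightarrow> nat \<Rightarrow> nat \<Rightarrow> real ^ 'n" where
  "point n P i = vec_of (\<lambda>c. real (grid CARD('n) R n P i c) / 4 ^ n - R)"

lemma point_nth: "c < CARD('n) \<Longrightarrow> point n P i $ (coord_enum ! c) = real (grid CARD('n) R n P i c) / 4 ^ n - R"
  by (simp add: point_def)

lemma R_pos: "0 < R"
  using bound[OF \<gamma>_mem[of 0] c0] by simp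

lemma feasible_step:
  assumes "feasible CARD('n) R u v c0 S n L P" "i < 2 ^ n"
  shows "dist (point n P i) (point n P (Suc i)) \<le> (real L / 4 ^ n + CARD('n) / 2 ^ n) / 2 ^ n"
proof -
  define X where "X = grid CARD('n) R n P"
  have "(\<Sum>c<CARD('n). (adiff (X (Suc i) c) (X i c))\<^sup>2) * (2 ^ n)\<^sup>2 \<le> (L + CARD('n) * 2 ^ n)\<^sup>2"
    using assms unfolding feasible_def X_def by blast
  then have "real ((\<Sum>c<CARD('n). (adiff (X (Suc i) c) (X i c))\<^sup>2) * (2 ^ n)\<^sup>2) \<le> real ((L + CARD('n) * 2 ^ n)\<^sup>2)"
    by (simp only: of_nat_le_iff)
  then have 1: "(\<Sum>c<CARD('n). (real (X (Suc i) c) - real (X i c))\<^sup>2) * (2 ^ n)\<^sup>2 \<le> (L + CARD('n) * 2 ^ n)\<^sup>2" by simp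
  have "(norm (point n P (Suc i) - point n P i))\<^sup>2
      = (\<Sum>c<CARD('n). ((real (X (Suc i) c) - real (X i c)) / 4 ^ n)\<^sup>2)"
    unfolding norm_vec_coord(1) by (intro sum.cong) (simp_all add: point_nth X_def diff_divide_distrib)
  also have "\<dots> = (\<Sum>c<CARD('n). (real (X (Suc i) c) - real (X i c))\<^sup>2) / (4 ^ n)\<^sup>2"
    by (simp add: power_divide sum_divide_distrib)
  finally have "(norm (point n P (Suc i) - point n P i) * 4 ^ n * 2 ^ n)\<^sup>2
      = (\<Sum>c<CARD('n). (real (X (Suc i) c) - real (X i c))\<^sup>2) * (2 ^ n)\<^sup>2"
    by (simp add: power_mult_distrib)
  then have "(norm (point n P (Suc i) - point n P i) * 4 ^ n * 2 ^ n)\<^sup>2 \<le> (real (L + CARD('n) * 2 ^ n))\<^sup>2"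
    using 1 by simp
  then have "norm (point n P (Suc i) - point n P i) * 4 ^ n * 2 ^ n \<le> real (L + CARD('n) * 2 ^ n)"
    by (rule power2_le_imp_le) simp
  then have "norm (point n P (Suc i) - point n P i) \<le> real (L + CARD('n) * 2 ^ n) / (4 ^ n * 2 ^ n)"
    by (simp add: field_simps)
  also have "\<dots> = (real L / 4 ^ n + CARD('n) / 2 ^ n) / 2 ^ n"
  proof -
    have "(4::real) ^ n = 2 ^ n * 2 ^ n" by (simp flip: power_mult_distrib)
    then show ?thesis by (simp add: field_simps)
  qed
  finally show ?thesis by (simp add: dist_norm norm_minus_commute)
qed

text \<open>The 6 units are the 4 allowed by \<open>feasible\<close> and the 2 of the sample error;
  the factor \<open>CARD('n)\<close> passes from coordinates to the norm.\<close>

lemma feasible_near_sample: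
  fixes j :: nat
  assumes "feasible CARD('n) R u v c0 S n L P" "j \<le> 2 ^ n"
  shows "\<exists>i\<le>2 ^ n. dist (\<gamma>s (j / 2 ^ n)) (point n P i) \<le> CARD('n) * ((real L / 4 ^ n) / 2 ^ n + 6 / 4 ^ n)"
proof -
  obtain i where i: "i \<le> 2 ^ n"
      "\<And>c. c < CARD('n) \<Longrightarrow> adiff (S n j c) (grid CARD('n) R n P i c) * 2 ^ n \<le> L + 4 * 2 ^ n"
    using assms unfolding feasible_def by (metis less_Suc_eq_le)
  have "norm (\<gamma>s (j / 2 ^ n) - point n P i) \<le> CARD('n) * ((real L / 4 ^ n) / 2 ^ n + 6 / 4 ^ n)"
  proof (rule norm_vec_le_coord)
    fix c assume c: "c < CARD('n)"
    let ?k = "(coord_enum :: 'n list) ! c"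
    have "real (adiff (S n j c) (grid CARD('n) R n P i c) * 2 ^ n) \<le> real (L + 4 * 2 ^ n)"
      using i(2)[OF c] by (simp only: of_nat_le_iff)
    then have "\<bar>real (S n j c) - real (grid CARD('n) R n P i c)\<bar> \<le> real L / 2 ^ n + 4" by (simp add: field_simps)
    then have "\<bar>(\<gamma>s (j / 2 ^ n) $ ?k + R) * 4 ^ n - real (grid CARD('n) R n P i c)\<bar> \<le> real L / 2 ^ n + 6"
      using sample[OF assms(2) c] by linarith
    moreover have "(\<gamma>s (j / 2 ^ n) $ ?k + R) * 4 ^ n - real (grid CARD('n) R n P i c)
        = (\<gamma>s (j / 2 ^ n) - point n P i) $ ?k * 4 ^ n"
      using c by (simp add: point_nth field_simps)
    ultimately have "\<bar>(\<gamma>s (j / 2 ^ n) - point n P i) $ ?k\<bar> * 4 ^ n \<le> real L / 2 ^ n + 6"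
      by (simp add: abs_mult)
    then show "\<bar>(\<gamma>s (j / 2 ^ n) - point n P i) $ ?k\<bar> \<le> (real L / 4 ^ n) / 2 ^ n + 6 / 4 ^ n"
      by (simp add: field_simps)
  qed
  then show ?thesis using i(1) by (auto simp: dist_norm)
qed

text \<open>Otherwise infinitely many stages would carry a bad polygon, and
  \<open>polygons_close\<close> finds a good one among these. Compactness gives no rate, hence the
  bare \<open>eventually\<close>.\<close>

lemma feasible_close:
  assumes L: "\<And>n. l * 4 ^ n \<le> real (L n)" "\<And>n. real (L n) \<le> l * 4 ^ n + 4" and e: "0 < e"
  shows "\<forall>\<^sub>F n in sequentially. \<forall>P. feasible CARD('n) R u v c0 S n (L n) P \<longrightarrow>
           (\<forall>i\<le>2 ^ n. dist (point n P i) (\<gamma> (i / 2 ^ n)) < e)"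
proof (rule ccontr)
  assume "\<not> ?thesis"
  then obtain r where r: "strict_mono (r :: nat \<Rightarrow> nat)" and
    "\<forall>k. \<not> (\<forall>P. feasible CARD('n) R u v c0 S (r k) (L (r k)) P \<longrightarrow>
           (\<forall>i\<le>2 ^ r k. dist (point (r k) P i) (\<gamma> (i / 2 ^ r k)) < e))"
    using not_eventually_sequentiallyD by blast
  then obtain P where P: "\<And>k. feasible CARD('n) R u v c0 S (r k) (L (r k)) (P k)"
    and bad: "\<And>k. \<not> (\<forall>i\<le>2 ^ r k. dist (point (r k) (P k) i) (\<gamma> (i / 2 ^ r k)) < e)"
    by metis
  have p2: "(\<lambda>n. c / 2 ^ n) \<longlonglongrightarrow> 0" for c :: real
    using tendsto_mult[OF tendsto_const[of c] LIMSEQ_inverse_realpow_zero[of 2]] by (simp add: divide_inverse)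
  have p4: "(\<lambda>n. c / 4 ^ n) \<longlonglongrightarrow> 0" for c :: real
    using tendsto_mult[OF tendsto_const[of c] LIMSEQ_inverse_realpow_zero[of 4]] by (simp add: divide_inverse)
  have Ll: "(\<lambda>n. real (L n) / 4 ^ n) \<longlonglongrightarrow> l"
  proof (rule tendsto_sandwich)
    show "\<forall>\<^sub>F n in sequentially. l \<le> real (L n) / 4 ^ n" using L(1) by (simp add: field_simps)
    show "\<forall>\<^sub>F n in sequentially. real (L n) / 4 ^ n \<le> l + 4 / 4 ^ n" using L(2) by (simp add: field_simps)
    show "(\<lambda>n. l + 4 / 4 ^ n) \<longlonglongrightarrow> l" using tendsto_add[OF tendsto_const p4[of 4]] by simp
  qed simp
  define K where "K n = real (L n) / 4 ^ n + CARD('n) / 2 ^ n" for n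
  have K: "K \<longlonglongrightarrow> l" unfolding K_def using tendsto_add[OF Ll p2] by simp
  define \<epsilon> where "\<epsilon> n = CARD('n) * ((real (L n) / 4 ^ n) / 2 ^ n + 6 / 4 ^ n)" for n
  have \<epsilon>: "\<epsilon> \<longlonglongrightarrow> 0"
  proof -
    have "(\<lambda>n. (real (L n) / 4 ^ n) * (1 / 2 ^ n)) \<longlonglongrightarrow> l * 0" by (intro tendsto_mult Ll p2)
    from tendsto_mult[OF tendsto_const[of "real CARD('n)"] tendsto_add[OF this p4[of 6]]]
    show ?thesis by (simp add: \<epsilon>_def[abs_def])
  qed
  \<comment> \<open>The sign turns the inequality between the vertices \<open>u * 2 ^ n\<close> and
    \<open>v * 2 ^ n\<close> into one between the first and the last vertex.\<close>
  define b where "b = (real v - real u) *\<^sub>R axis ((coord_enum :: 'n list) ! c0) (1::real)"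
  have inner_b: "x \<bullet> b = (real v - real u) * x $ (coord_enum ! c0)" for x by (simp add: b_def inner_axis)
  have "\<exists>k. \<forall>i\<le>2 ^ r k. dist (point (r k) (P k) i) (\<gamma> (i / real (2 ^ r k))) < e"
  proof (rule polygons_close[OF par, where K = "\<lambda>k. K (r k)" and b = b and M = "CARD('n) * real R"])
    show "(\<lambda>k. K (r k)) \<longlonglongrightarrow> l" using LIMSEQ_subseq_LIMSEQ[OF K r] by (simp add: comp_def)
    show "dist (point (r k) (P k) i) (point (r k) (P k) (Suc i)) \<le> K (r k) / real (2 ^ r k)" if "i < 2 ^ r k" for k i
      using feasible_step[OF P that] by (simp add: K_def)
    show "norm (point (r k) (P k) i) \<le> CARD('n) * real R" if "i \<le> 2 ^ r k" for k i
    proof (rule norm_vec_le_coord)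
      fix c assume c: "c < CARD('n)"
      have "real (grid CARD('n) R (r k) (P k) i c) \<le> real (2 * R * 4 ^ r k)"
        using grid_less[OF R_pos, of "CARD('n)" "r k" "P k" i c] by (simp only: of_nat_le_iff less_imp_le)
      then have "real (grid CARD('n) R (r k) (P k) i c) / 4 ^ r k \<le> 2 * R" by (simp add: field_simps)
      then show "\<bar>point (r k) (P k) i $ (coord_enum ! c)\<bar> \<le> R" using c by (simp add: point_nth abs_le_iff)
    qed
    show "\<Gamma> \<subseteq> closure {\<gamma>s (real j / 2 ^ n) | j n. j \<le> 2 ^ n}" by (rule dense)
    show "\<forall>\<^sub>F k in sequentially. \<exists>i\<le>2 ^ r k. dist y (point (r k) (P k) i) < e'"
      if y: "y \<in> {\<gamma>s (real j / 2 ^ n) | j n. j \<le> 2 ^ n}" and e': "0 < e'" for y e'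
    proof -
      obtain j m where j: "j \<le> 2 ^ m" "y = \<gamma>s (real j / 2 ^ m)" using y by blast
      have "(\<lambda>k. \<epsilon> (r k)) \<longlonglongrightarrow> 0" using LIMSEQ_subseq_LIMSEQ[OF \<epsilon> r] by (simp add: comp_def)
      from order_tendstoD(2)[OF this e'] eventually_ge_at_top[of m] show ?thesis
      proof eventually_elim
        case (elim k)
        \<comment> \<open>A dyadic time of level \<open>m\<close> is again a sample time at each
          later stage, with numerator \<open>j * 2 ^ (r k - m)\<close>.\<close>
        have mr: "m \<le> r k" using elim(2) seq_suble[OF r, of k] by simp
        then have pow: "2 ^ r k = 2 ^ m * (2::'b::comm_semiring_1) ^ (r k - m)" by (simp flip: power_add)
        have "j * 2 ^ (r k - m) \<le> 2 ^ r k" unfolding pow using j(1) by simp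
        from feasible_near_sample[OF P[of k] this] obtain i where i: "i \<le> 2 ^ r k"
          "dist (\<gamma>s (real (j * 2 ^ (r k - m)) / 2 ^ r k)) (point (r k) (P k) i) \<le> \<epsilon> (r k)"
          unfolding \<epsilon>_def by blast
        have "real (j * 2 ^ (r k - m)) / 2 ^ r k = real j / 2 ^ m" unfolding pow by simp
        then have "dist y (point (r k) (P k) i) < e'" using i(2) elim(1) j(2) by simp
        then show ?case using i(1) by blast
      qed
    qed
    show "point (r k) (P k) 0 \<bullet> b \<le> point (r k) (P k) (2 ^ r k) \<bullet> b" for k
    proof -
      have "grid CARD('n) R (r k) (P k) (u * 2 ^ r k) c0 \<le> grid CARD('n) R (r k) (P k) (v * 2 ^ r k) c0"
        using P[of k] unfolding feasible_def by blast
      then show ?thesis using uv c0 by (auto simp: inner_b point_nth divide_right_mono)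
    qed
    show "\<gamma> 0 \<bullet> b < \<gamma> 1 \<bullet> b" using uv by (auto simp: inner_b)
  qed (use e in auto)
  then obtain k where "\<forall>i\<le>2 ^ r k. dist (point (r k) (P k) i) (\<gamma> (i / real (2 ^ r k))) < e" by blast
  then show False using bad[of k] by simp
qed

lemma ex_rounded_grid:
  "\<exists>P<(2 * R * 4 ^ n) ^ (Suc (2 ^ n) * CARD('n)). \<forall>i\<le>2 ^ n. \<forall>c<CARD('n). grid CARD('n) R n P i c = rounded n i c"
proof -
  have "rounded n i c < 2 * R * 4 ^ n" if "i < Suc (2 ^ n)" "c < CARD('n)" for i c
    using rounded(3)[of i n c] that by simp
  from ex_grid[of "Suc (2 ^ n)" "CARD('n)" "rounded n", OF this] show ?thesis
    by (simp only: less_Suc_eq_le)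
qed

lemma rounded_close:
  assumes "i \<le> 2 ^ n" "c < CARD('n)"
  shows "\<bar>real (rounded n i c) / 4 ^ n - R - \<gamma> (i / 2 ^ n) $ (coord_enum ! c)\<bar> \<le> 1 / 4 ^ n"
proof -
  have "real (rounded n i c) / 4 ^ n - R - \<gamma> (i / 2 ^ n) $ (coord_enum ! c)
      = (real (rounded n i c) - (\<gamma> (i / 2 ^ n) $ (coord_enum ! c) + R) * 4 ^ n) / 4 ^ n"
    by (simp add: field_simps)
  moreover have "\<bar>real (rounded n i c) - (\<gamma> (i / 2 ^ n) $ (coord_enum ! c) + R) * 4 ^ n\<bar> \<le> 1"
    using rounded(1,2)[OF assms] by linarith
  ultimately show ?thesis by (simp add: divide_right_mono)
qed

text \<open>Among the polygons that \<open>Q\<close> is compared with is the rounding of \<gamma>,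
  which contributes the term \<open>1 / 4 ^ n\<close>.\<close>

lemma settled_sound:
  assumes settled: "settled CARD('n) R u v c0 S n L i Q r" and L: "l * 4 ^ n \<le> real L"
    and i: "i \<le> 2 ^ n" and c: "c < CARD('n)"
  shows "\<bar>real (grid CARD('n) R n Q i c) / 4 ^ n - R - \<gamma> (i / 2 ^ n) $ (coord_enum ! c)\<bar>
           \<le> 1 / (2 ^ r * (4 * CARD('n))) + 1 / 4 ^ n"
proof -
  obtain P where P: "P < (2 * R * 4 ^ n) ^ (Suc (2 ^ n) * CARD('n))"
    "\<And>i c. i \<le> 2 ^ n \<Longrightarrow> c < CARD('n) \<Longrightarrow> grid CARD('n) R n P i c = rounded n i c"
    using ex_rounded_grid[of n] by blast
  have "feasible CARD('n) R u v c0 S n L P" by (rule feasible_rounded[OF L P(2)])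
  then have "adiff (grid CARD('n) R n P i c) (grid CARD('n) R n Q i c) * (2 ^ r * (4 * CARD('n))) \<le> 4 ^ n"
    using settled P(1) c unfolding settled_def by blast
  then have "real (adiff (rounded n i c) (grid CARD('n) R n Q i c) * (2 ^ r * (4 * CARD('n)))) \<le> real (4 ^ n)"
    unfolding P(2)[OF i c] by (simp only: of_nat_le_iff)
  then have "\<bar>real (rounded n i c) - real (grid CARD('n) R n Q i c)\<bar> / 4 ^ n \<le> 1 / (2 ^ r * (4 * CARD('n)))"
    by (simp add: field_simps)
  then have "\<bar>real (rounded n i c) / 4 ^ n - real (grid CARD('n) R n Q i c) / 4 ^ n\<bar> \<le> 1 / (2 ^ r * (4 * CARD('n)))"
    by (simp flip: diff_divide_distrib)
  then show ?thesis using rounded_close[OF i c] by linarith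
qed

text \<open>The witness \<open>Q\<close> is the rounding of \<gamma>, unknown to the algorithm but
  met by its search. The offset \<open>k\<close> lets the caller force a minimal stage.\<close>

lemma ex_settled:
  assumes L: "\<And>n. l * 4 ^ n \<le> real (L n)" "\<And>n. real (L n) \<le> l * 4 ^ n + 4"
  shows "\<exists>m Q. \<forall>i\<le>2 ^ (k + m). settled CARD('n) R u v c0 S (k + m) (L (k + m)) i Q r"
proof -
  \<comment> \<open>Half of the tolerance in \<open>settled\<close>: a feasible polygon and the
    rounding are each within \<open>e\<close> of \<gamma>.\<close>
  define e where "e = 1 / (2 ^ r * (8 * real CARD('n)))"
  have e: "0 < e" by (simp add: e_def)
  have "(\<lambda>n. 1 / 4 ^ n) \<longlonglongrightarrow> (0::real)"
    using LIMSEQ_inverse_realpow_zero[of 4] by (simp add: divide_inverse)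
  from eventually_conj[OF order_tendstoD(2)[OF this e] feasible_close[OF L e]]
  obtain n0 where n0: "\<And>n. n0 \<le> n \<Longrightarrow> 1 / 4 ^ n < e \<and> (\<forall>P. feasible CARD('n) R u v c0 S n (L n) P \<longrightarrow>
           (\<forall>i\<le>2 ^ n. dist (point n P i) (\<gamma> (i / 2 ^ n)) < e))"
    unfolding eventually_at_top_linorder by blast
  define n where "n = k + n0"
  obtain Q where Q: "\<And>i c. i \<le> 2 ^ n \<Longrightarrow> c < CARD('n) \<Longrightarrow> grid CARD('n) R n Q i c = rounded n i c"
    using ex_rounded_grid[of n] by blast
  have "settled CARD('n) R u v c0 S n (L n) i Q r" if i: "i \<le> 2 ^ n" for i
    unfolding settled_def
  proof (intro allI impI)
    fix P c assume P: "feasible CARD('n) R u v c0 S n (L n) P" and c: "c < CARD('n)"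
    let ?x = "\<gamma> (i / 2 ^ n) $ (coord_enum ! c)"
    have "dist (point n P i) (\<gamma> (i / 2 ^ n)) < e" using n0[of n] P i by (simp add: n_def)
    then have "\<bar>(point n P i - \<gamma> (i / 2 ^ n)) $ (coord_enum ! c)\<bar> < e"
      unfolding dist_norm by (rule order_le_less_trans[OF component_le_norm_cart])
    then have "\<bar>real (grid CARD('n) R n P i c) / 4 ^ n - R - ?x\<bar> < e" using c by (simp add: point_nth)
    moreover have "\<bar>real (rounded n i c) / 4 ^ n - R - ?x\<bar> < e"
      using rounded_close[OF i c] n0[of n] by (simp add: n_def)
    ultimately have "\<bar>real (grid CARD('n) R n P i c) / 4 ^ n - real (rounded n i c) / 4 ^ n\<bar> \<le> 2 * e" by linarith
    then have "\<bar>real (grid CARD('n) R n P i c) - real (rounded n i c)\<bar> / 4 ^ n \<le> 2 * e"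
      by (simp flip: diff_divide_distrib)
    then have "\<bar>real (grid CARD('n) R n P i c) - real (rounded n i c)\<bar> * (2 ^ r * (4 * CARD('n))) \<le> 4 ^ n"
      by (simp add: e_def field_simps)
    then have "real (adiff (grid CARD('n) R n P i c) (rounded n i c) * (2 ^ r * (4 * CARD('n)))) \<le> real (4 ^ n)"
      by simp
    then show "adiff (grid CARD('n) R n P i c) (grid CARD('n) R n Q i c) * (2 ^ r * (4 * CARD('n))) \<le> 4 ^ n"
      unfolding Q[OF i c] by (simp only: of_nat_le_iff)
  qed
  then show ?thesis unfolding n_def by blast
qed

end

subsection \<open>The algorithm\<close>

lemma Rec_comp3:
  assumes "Rec 3 (\<lambda>os e. f os (e 0) (e 1) (e 2))" "Rec k A" "Rec k B" "Rec k C"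
  shows "Rec k (\<lambda>os e. f os (A os e) (B os e) (C os e))"
  using Rec_comp[OF assms(1), of k "\<lambda>i. if i = 0 then A else if i = 1 then B else C"] assms(2-) by simp

text \<open>Makes a given machine, which may itself contain minimization, available as a total
  function, provided that it halts on all inputs arising from \<open>A\<close> and
  \<open>Q\<close>.\<close>

lemma Rec_const_oracle:
  assumes A: "Rec k A" and Q: "Rec k Q"
    and M: "\<And>os e. reval [\<lambda>_. Q os e] M [A os e] (F os e)"
  shows "Rec k F"
proof -
  obtain a where a: "\<And>os e. length os = 2 \<Longrightarrow> reval os a (map e [0..<k]) (A os e)"
    using A unfolding Rec_def by blast
  obtain q where q: "\<And>os e. length os = 2 \<Longrightarrow> reval os q (map e [0..<k]) (Q os e)"
    using Q unfolding Rec_def by blast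
  show ?thesis unfolding Rec_def
  proof (intro exI allI impI)
    fix os :: "(nat \<Rightarrow> nat) list" and e :: "nat \<Rightarrow> nat" assume os: "length os = 2"
    have "list_all2 (\<lambda>g. reval os g (map e [0..<k])) [a, q] [A os e, Q os e]" using a[OF os] q[OF os] by simp
    moreover have "reval os (const_oracle M 1) [A os e, Q os e] (F os e)"
      using reval_const_oracle[OF M, of os os e] by simp
    ultimately show "reval os (Cn (const_oracle M 1) [a, q]) (map e [0..<k]) (F os e)" by (rule reval.comp)
  qed
qed

lemma Rec_adiff:
  assumes "Rec k A" "Rec k B"
  shows "Rec k (\<lambda>os e. adiff (A os e) (B os e))"
  unfolding adiff_def by (intro Rec_add Rec_diff assms)

lemma Rec_scaled_code:
  assumes "Rec k A" "Rec k B"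
  shows "Rec k (\<lambda>os e. scaled_code R (A os e) (B os e))"
  unfolding scaled_code_def
  by (intro Rec_if Rec_even Rec_add Rec_diff Rec_mult Rec_div Rec_power Rec_Suc
      Rec_prod_decode_fst Rec_prod_decode_snd Rec_const assms)

lemma Rec_code_nth:
  assumes "Rec k A" "Rec k B"
  shows "Rec k (\<lambda>os e. code_nth (A os e) (B os e))"
proof -
  have "Rec 2 (\<lambda>os e. code_nth (e 0) (e 1))"
    unfolding code_nth_def code_tl_def
    by (intro Rec_prod_decode_fst Rec_diff Rec_const Rec_rec_nat Rec_prod_decode_snd Rec_var) auto
  from Rec_comp2[OF this assms] show ?thesis .
qed

lemma Rec_grid:
  assumes "Rec k N" "Rec k P" "Rec k I" "Rec k C"
  shows "Rec k (\<lambda>os e. grid d R (N os e) (P os e) (I os e) (C os e))"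
  unfolding grid_def digit_def
  by (intro Rec_mod Rec_div Rec_power Rec_mult Rec_add Rec_const assms)

lemma Rec_feasible:
  assumes S: "Rec 3 (\<lambda>os e. S (e 0) (e 1) (e 2))"
    and "Rec k N" "Rec k L" "Rec k P"
  shows "RecP k (\<lambda>os e. feasible d R u v c0 S (N os e) (L os e) (P os e))"
proof -
  have "RecP 3 (\<lambda>os e. feasible d R u v c0 S (e 0) (e 1) (e 2))"
    unfolding feasible_def
    by (intro Rec_conj Rec_all Rec_ex Rec_le Rec_sum Rec_mult Rec_add Rec_power Rec_Suc Rec_adiff
        Rec_grid Rec_comp3[OF S] Rec_const Rec_var) auto
  from Rec_comp3[OF this assms(2-)] show ?thesis .
qed

lemma Rec_settled:
  assumes S: "Rec 3 (\<lambda>os e. S (e 0) (e 1) (e 2))"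
    and L: "Rec 1 (\<lambda>os e. L os (e 0))" and I: "Rec 1 (\<lambda>os e. I os (e 0))"
    and "Rec k N" "Rec k Q" "Rec k A"
  shows "RecP k (\<lambda>os e. settled d R u v c0 S (N os e) (L os (N os e)) (I os (N os e)) (Q os e) (A os e))"
proof -
  have "RecP 3 (\<lambda>os e. settled d R u v c0 S (e 0) (L os (e 0)) (I os (e 0)) (e 1) (e 2))"
    unfolding settled_def
    by (intro Rec_all Rec_imp Rec_feasible[OF S] Rec_le Rec_mult Rec_power Rec_Suc Rec_adiff
        Rec_grid Rec_comp1[OF L] Rec_comp1[OF I] Rec_const Rec_var) auto
  from Rec_comp3[OF this assms(4-)] show ?thesis .
qed

text \<open>Code of \<open>x / 2 ^ s - R\<close>, undoing the shift and scaling of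
  \<open>scaled_code\<close>. Both subtractions of 1 match conventions: \<open>int_decode\<close>
  starts the odd numbers at -1, and \<open>rat_of_code\<close> has the denominator
  \<open>Suc b\<close>.\<close>

definition decoded_code :: "nat \<Rightarrow> nat \<Rightarrow> nat \<Rightarrow> nat" where
  "decoded_code R s x = prod_encode
     (if R * 2 ^ s \<le> x then 2 * (x - R * 2 ^ s) else Suc (2 * (R * 2 ^ s - x - 1)), 2 ^ s - 1)"

lemma Rec_decoded_code:
  assumes "Rec k A" "Rec k B"
  shows "Rec k (\<lambda>os e. decoded_code R (A os e) (B os e))"
  unfolding decoded_code_def
  by (intro Rec_prod_encode Rec_if Rec_le Rec_mult Rec_diff Rec_power Rec_Suc Rec_const assms)

lemma decoded_code: "real_of_rat (rat_of_code (decoded_code R s x)) = real x / 2 ^ s - real R"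
proof -
  have "int_decode (if R * 2 ^ s \<le> x then 2 * (x - R * 2 ^ s) else Suc (2 * (R * 2 ^ s - x - 1)))
      = int x - int (R * 2 ^ s)"
    by (auto simp: int_decode_def sum_decode_def of_nat_diff)
  moreover have "rat_of_nat (Suc (2 ^ s - 1)) = 2 ^ s" by simp
  ultimately have "rat_of_code (decoded_code R s x) = of_int (int x - int (R * 2 ^ s)) / 2 ^ s"
    by (simp add: rat_of_code_def decoded_code_def)
  then show ?thesis by (simp add: of_rat_divide of_rat_power of_rat_diff of_rat_mult diff_divide_distrib)
qed

text \<open>Capping \<open>j\<close> keeps the coded time in the unit interval for all arguments, so
  the machine run on it yields a total function.\<close>

definition dyadic_code :: "nat \<Rightarrow> nat \<Rightarrow> nat" where
  "dyadic_code n j = prod_encode (2 * min j (2 ^ n), 2 ^ n - 1)"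

lemma dyadic_code: "real_of_rat (rat_of_code (dyadic_code n j)) = real (min j (2 ^ n)) / 2 ^ n"
  by (simp add: dyadic_code_def rat_of_code_def int_decode_def sum_decode_def of_rat_divide of_rat_power)

lemma Rec_dyadic_code:
  assumes "Rec k A" "Rec k B"
  shows "Rec k (\<lambda>os e. dyadic_code (A os e) (B os e))"
  unfolding dyadic_code_def
  by (intro Rec_prod_encode Rec_mult Rec_min Rec_diff Rec_power Rec_const assms)

lemma two_powr_minus: "2 powr (- real s) = 1 / 2 ^ s"
  by (simp add: powr_minus powr_realpow divide_inverse)

lemma ex_rat_code: "\<exists>k. rat_of_code k = q"
proof -
  obtain a b where ab: "quotient_of q = (a, b)" by fastforce
  have b: "b > 0" using quotient_of_denom_pos[OF ab] .
  have "rat_of_code (prod_encode (int_encode a, nat b - 1)) = of_int a / of_nat (Suc (nat b - 1))"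
    by (simp add: rat_of_code_def)
  also have "rat_of_nat (Suc (nat b - 1)) = of_int b" using b by (simp add: of_nat_nat)
  finally show ?thesis using quotient_of_div[OF ab] by auto
qed

text \<open>A dyadic \<open>x\<close> close enough to \<open>t\<close> has an oracle that agrees
  with one for \<open>t\<close> on all positions read. Both runs give the same output, so
  \<open>f x\<close> and \<open>f t\<close> differ by at most twice the precision.\<close>

lemma computable_fun_dyadic_dense:
  assumes "computable_fun f"
  shows "f ` {0..1} \<subseteq> closure {f (real j / 2 ^ n) | j n. j \<le> 2 ^ n}"
proof
  fix y assume "y \<in> f ` {0..1}"
  then obtain t where t: "t \<in> {0..1}" "y = f t" by blast
  obtain M where M: "\<And>t Ot g r. t \<in> {0..1} \<Longrightarrow> is_oracle Ot t \<Longrightarrow> codes_oracle g Ot \<Longrightarrow>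
      \<exists>c. reval [g] M [r] c \<and> dist (point_of_code c) (f t) \<le> 2 powr (- real r)"
    using assms unfolding computable_fun_def by metis
  show "y \<in> closure {f (real j / 2 ^ n) | j n. j \<le> 2 ^ n}"
    unfolding closure_approachable
  proof (intro allI impI)
    fix e :: real assume "0 < e"
    then obtain r where r: "(1 / 2) ^ r < e / 2" using real_arch_pow_inv[of "e / 2" "1 / 2"] by auto
    \<comment> \<open>The oracle for \<open>t\<close> uses half of the permitted error; the other
      half absorbs the distance from \<open>t\<close> to \<open>x\<close>.\<close>
    have "\<exists>k. \<bar>real_of_rat (rat_of_code k) - t\<bar> \<le> 1 / 2 ^ Suc s" for s
    proof -
      obtain q where "t < real_of_rat q" "real_of_rat q < t + 1 / 2 ^ Suc s"
        using of_rat_dense[of t "t + 1 / 2 ^ Suc s"] by auto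
      moreover obtain k where "rat_of_code k = q" using ex_rat_code by blast
      ultimately show ?thesis by (intro exI[of _ k]) simp
    qed
    then obtain g where g: "\<And>s. \<bar>real_of_rat (rat_of_code (g s)) - t\<bar> \<le> 1 / 2 ^ Suc s" by metis
    have "is_oracle (\<lambda>s. rat_of_code (g s)) t"
      unfolding is_oracle_def two_powr_minus
    proof
      show "\<bar>real_of_rat (rat_of_code (g s)) - t\<bar> \<le> 1 / 2 ^ s" for s
        by (rule order_trans[OF g]) (simp add: field_simps)
    qed
    then obtain c where c: "reval [g] M [r] c" "dist (point_of_code c) (f t) \<le> 2 powr (- real r)"
      using M[OF t(1), of "\<lambda>s. rat_of_code (g s)" g r] by (auto simp: codes_oracle_def)
    obtain U where U: "\<And>g'. (\<forall>s<U. g' s = g s) \<Longrightarrow> reval [g'] M [r] c" using reval_use[OF c(1)] by blast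
    define j where "j = nat \<lfloor>t * 2 ^ Suc U\<rfloor>"
    have j: "real j \<le> t * 2 ^ Suc U" "t * 2 ^ Suc U < real j + 1"
      using t(1) unfolding j_def by (simp_all del: power_Suc)
    have "t * 2 ^ Suc U \<le> 1 * 2 ^ Suc U" using t(1) by (intro mult_right_mono) auto
    from order_trans[OF j(1) this] have "real j \<le> real (2 ^ Suc U)" by simp
    then have jU: "j \<le> 2 ^ Suc U" by (simp only: of_nat_le_iff)
    define x where "x = real j / 2 ^ Suc U"
    have x01: "x \<in> {0..1}"
    proof -
      have "real j \<le> 2 ^ Suc U" using \<open>real j \<le> real (2 ^ Suc U)\<close> by simp
      then show ?thesis by (simp add: x_def del: power_Suc)
    qed
    have "\<bar>t * 2 ^ Suc U - real j\<bar> / 2 ^ Suc U \<le> 1 / 2 ^ Suc U"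
      using j by (intro divide_right_mono) auto
    moreover have "\<bar>t * 2 ^ Suc U - real j\<bar> / 2 ^ Suc U = \<bar>t - x\<bar>"
    proof -
      have "(t * 2 ^ Suc U - real j) / 2 ^ Suc U = t - x" by (simp add: x_def diff_divide_distrib)
      then show ?thesis by (metis abs_divide abs_of_nonneg zero_le_numeral zero_le_power)
    qed
    ultimately have tx: "\<bar>t - x\<bar> \<le> 1 / 2 ^ Suc U" by simp
    \<comment> \<open>Beyond the positions read, the answers switch to the exact value
      \<open>x\<close>.\<close>
    define g' where "g' s = (if s < U then g s else dyadic_code (Suc U) j)" for s
    have "\<bar>real_of_rat (rat_of_code (g' s)) - x\<bar> \<le> 1 / 2 ^ s" for s
    proof (cases "s < U")
      case True
      have "1 / 2 ^ Suc U \<le> (1 :: real) / 2 ^ Suc s" using True by (intro divide_left_mono power_increasing) auto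
      then have "\<bar>real_of_rat (rat_of_code (g s)) - x\<bar> \<le> 1 / 2 ^ Suc s + 1 / 2 ^ Suc s" using g[of s] tx by linarith
      then show ?thesis using True by (simp add: g'_def)
    next
      case False
      then show ?thesis using jU by (simp add: g'_def dyadic_code x_def min_absorb1 del: power_Suc)
    qed
    then have "is_oracle (\<lambda>s. rat_of_code (g' s)) x" unfolding is_oracle_def two_powr_minus by blast
    then obtain c' where c': "reval [g'] M [r] c'" "dist (point_of_code c') (f x) \<le> 2 powr (- real r)"
      using M[OF x01, of "\<lambda>s. rat_of_code (g' s)" g' r] by (auto simp: codes_oracle_def)
    have "reval [g'] M [r] c" by (rule U) (simp add: g'_def)
    from reval_deterministic[OF c'(1) this] have cc: "c = c'" .
    have "dist (f x) y \<le> 1 / 2 ^ r + 1 / 2 ^ r"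
      using c(2) c'(2) dist_triangle3[of "f x" y "point_of_code c"] unfolding two_powr_minus t(2) cc by linarith
    also have "\<dots> < e" using r by (simp add: power_one_over)
    finally show "\<exists>z\<in>{f (real j / 2 ^ n) | j n. j \<le> 2 ^ n}. dist z y < e"
      unfolding x_def using jU by blast
  qed
qed

theorem theorem5p1:
  fixes \<gamma>star \<gamma> :: "real \<Rightarrow> real ^ 'n::finite"
    and \<Gamma> :: "(real ^ 'n) set"
    and l :: real
    and Ol :: "nat \<Rightarrow> rat"
  assumes "computable_fun \<gamma>star"
    and "\<Gamma> = \<gamma>star ` {0..1}"
    and "simple_curve \<Gamma>"
    and "rectifiable_curve \<Gamma>"
    and "hausdorff1 \<Gamma> = ennreal l"
    and "is_oracle Ol l"
    and "normalized_constant_speed_param \<gamma> \<Gamma>"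
  shows "computable_fun_with_oracle Ol \<gamma>"
proof -
  note par = assms(7) assms(5)
  let ?d = "CARD('n)"
  have lp: "0 < l" by (rule param_length_pos[OF par])
  have "compact \<Gamma>" using compact_continuous_image[OF param_cont[OF par]] by (simp add: param_image[OF par])
  then obtain B where B: "\<And>x. x \<in> \<Gamma> \<Longrightarrow> norm x \<le> B" using compact_imp_bounded[of \<Gamma>] unfolding bounded_iff by blast
  obtain R :: nat where "B < R" using reals_Archimedean2 by blast
  then have bound: "\<bar>x $ (coord_enum ! c)\<bar> < R" if "x \<in> \<Gamma>" for x c
    using component_le_norm_cart[of x "coord_enum ! c"] B[OF that] by linarith
  obtain k where "\<gamma> 0 $ k \<noteq> \<gamma> 1 $ k" using param_ends[OF par] by (auto simp: vec_eq_iff)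
  then obtain c0 where c0: "c0 < ?d" "\<gamma> 0 $ (coord_enum ! c0) \<noteq> \<gamma> 1 $ (coord_enum ! c0)"
    using ex_coord[of k] by blast
  then obtain u v :: nat where uv:
    "u = 0 \<and> v = 1 \<and> \<gamma> 0 $ (coord_enum ! c0) < \<gamma> 1 $ (coord_enum ! c0) \<or>
     u = 1 \<and> v = 0 \<and> \<gamma> 1 $ (coord_enum ! c0) < \<gamma> 0 $ (coord_enum ! c0)"
  proof (cases "\<gamma> 0 $ (coord_enum ! c0) < \<gamma> 1 $ (coord_enum ! c0)")
    case True
    then show ?thesis using that[of 0 1] by simp
  next
    case False
    then show ?thesis using that[of 1 0] c0(2) by simp
  qed
  \<comment> \<open>Makes every stage from \<open>r + K\<close> on fine enough: 1 is for rounding to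
    the grid, \<open>2 * l\<close> for the time error \<open>2 / 2 ^ n\<close> at speed
    \<open>l\<close>.\<close>
  obtain K :: nat where K: "4 * ?d * (1 + 2 * l) \<le> 2 ^ K"
    using real_arch_pow[of 2 "4 * ?d * (1 + 2 * l)"] less_imp_le by auto
  obtain M where M: "\<And>t Ot g r. t \<in> {0..1} \<Longrightarrow> is_oracle Ot t \<Longrightarrow> codes_oracle g Ot \<Longrightarrow>
      \<exists>c. reval [g] M [r] c \<and> dist (point_of_code c) (\<gamma>star t) \<le> 2 powr (- real r)"
    using assms(1) unfolding computable_fun_def by metis
  have "\<exists>c. reval [\<lambda>_. dyadic_code n j] M [r] c \<and>
      dist (point_of_code c) (\<gamma>star (real (min j (2 ^ n)) / 2 ^ n)) \<le> 2 powr (- real r)" for n j r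
  proof (rule M)
    have "real (min j (2 ^ n)) \<le> real (2 ^ n)" by (simp only: of_nat_le_iff min.cobounded2)
    then show "real (min j (2 ^ n)) / 2 ^ n \<in> {0..1}" by (simp del: of_nat_min)
    show "is_oracle (\<lambda>_. rat_of_code (dyadic_code n j)) (real (min j (2 ^ n)) / 2 ^ n)"
      unfolding is_oracle_def dyadic_code by simp
  qed (simp add: codes_oracle_def)
  then obtain \<phi> where \<phi>: "\<And>n j r. reval [\<lambda>_. dyadic_code n j] M [r] (\<phi> n j r)"
    "\<And>n j r. dist (point_of_code (\<phi> n j r)) (\<gamma>star (real (min j (2 ^ n)) / 2 ^ n)) \<le> 2 powr (- real r)"
    by metis
  \<comment> \<open>Precision \<open>2 * n\<close> matches the unit \<open>4^-n\<close>; the machine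
    error and the rounding cost one unit each.\<close>
  define S where "S n j c = scaled_code R (2 * n) (code_nth (\<phi> n j (2 * n)) c)" for n j c
  have "Rec 3 (\<lambda>os e. \<phi> (e 0) (e 1) (2 * e 0))"
    by (rule Rec_const_oracle[where A = "\<lambda>os e. 2 * e 0" and Q = "\<lambda>os e. dyadic_code (e 0) (e 1)"])
       (use \<phi>(1) in \<open>auto intro!: Rec_mult Rec_const Rec_dyadic_code Rec_var\<close>)
  then have S: "Rec 3 (\<lambda>os e. S (e 0) (e 1) (e 2))"
    unfolding S_def by (intro Rec_scaled_code Rec_code_nth Rec_mult Rec_const Rec_var) auto
  have four: "(4::real) ^ n = 2 ^ (2 * n)" for n by (simp add: power_mult)
  have sample: "\<bar>real (S n j c) - (\<gamma>star (j / 2 ^ n) $ (coord_enum ! c) + R) * 4 ^ n\<bar> \<le> 2"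
    if j: "j \<le> 2 ^ n" and c: "c < ?d" for n j c
  proof -
    let ?x = "\<gamma>star (j / 2 ^ n) $ (coord_enum ! c)"
    let ?q = "real_of_rat (rat_of_code (code_nth (\<phi> n j (2 * n)) c))"
    have "real j \<le> real (2 ^ n)" using j by (simp only: of_nat_le_iff)
    then have "real j / 2 ^ n \<in> {0..1}" by simp
    then have "\<bar>?x\<bar> < R" using assms(2) by (intro bound) blast
    moreover have "\<bar>?q - ?x\<bar> \<le> 1 / 4 ^ n"
    proof -
      have "\<bar>(point_of_code (\<phi> n j (2 * n)) - \<gamma>star (j / 2 ^ n)) $ (coord_enum ! c)\<bar>
          \<le> dist (point_of_code (\<phi> n j (2 * n))) (\<gamma>star (j / 2 ^ n))"
        unfolding dist_norm by (rule component_le_norm_cart)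
      also have "\<dots> \<le> 2 powr (- real (2 * n))" using \<phi>(2)[of n j "2 * n"] j by (simp only: min_absorb1)
      also have "\<dots> = 1 / 4 ^ n" unfolding two_powr_minus four ..
      finally show ?thesis using c by (simp add: point_of_code_nth)
    qed
    ultimately have "\<bar>max 0 (?q + R) - (?x + R)\<bar> \<le> 1 / 4 ^ n" by linarith
    then have "\<bar>max 0 (?q + R) - (?x + R)\<bar> * 4 ^ n \<le> 1 / 4 ^ n * 4 ^ n" by (intro mult_right_mono) auto
    then have "\<bar>max 0 (?q + R) * 4 ^ n - (?x + R) * 4 ^ n\<bar> \<le> 1"
      by (simp add: abs_mult flip: left_diff_distrib)
    moreover have "\<bar>real (S n j c) - max 0 (?q + R) * 4 ^ n\<bar> \<le> 1"
      unfolding S_def four by (rule scaled_code)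
    ultimately show ?thesis by linarith
  qed
  note dense = computable_fun_dyadic_dense[OF assms(1), folded assms(2)]
  note ctx = par assms(2) bound sample dense c0(1) uv
  \<comment> \<open>Oracle error and rounding cost at most one unit each; adding 2 makes
    \<open>L\<close> an upper estimate, at most 4 units too large.\<close>
  define L where "L os n = scaled_code 0 (2 * n) ((os ! 1) (2 * n)) + 2" for os :: "(nat \<Rightarrow> nat) list" and n
  \<comment> \<open>The oracle may overshoot 1, so the index is capped at the last vertex. It lies
    within 2 of \<open>t * 2 ^ n\<close>, by oracle error and rounding.\<close>
  define I where "I os n = min (2 ^ n) (scaled_code 0 n ((os ! 0) n))" for os :: "(nat \<Rightarrow> nat) list" and n
  \<comment> \<open>The search variable \<open>w\<close> codes a pair: the excess of the stage over
    \<open>r + K\<close>, and the candidate \<open>Q\<close>.\<close>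
  define stage where "stage r w = r + K + fst (prod_decode w)" for r w
  define out where "out os w r =
    list_encode (map (\<lambda>c. decoded_code R (2 * stage r w)
      (grid ?d R (stage r w) (snd (prod_decode w)) (I os (stage r w)) c)) [0..<?d])" for os w r
  have L: "Rec 1 (\<lambda>os e. L os (e 0))" and I: "Rec 1 (\<lambda>os e. I os (e 0))"
    unfolding L_def I_def
    by (intro Rec_add Rec_min Rec_scaled_code Rec_oracle Rec_mult Rec_power Rec_const Rec_var; simp)+
  have stage: "Rec (Suc 1) (\<lambda>os e. stage (e (Suc 0)) (e 0))"
    unfolding stage_def by (intro Rec_add Rec_prod_decode_fst Rec_const Rec_var) auto
  have "RecP (Suc 1) (\<lambda>os e. settled ?d R u v c0 S (stage (e (Suc 0)) (e 0)) (L os (stage (e (Suc 0)) (e 0)))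
      (I os (stage (e (Suc 0)) (e 0))) (snd (prod_decode (e 0))) (e (Suc 0)))"
    by (rule Rec_settled[OF S L I stage]) (intro Rec_prod_decode_snd Rec_var; simp)+
  moreover have "Rec (Suc 1) (\<lambda>os e. out os (e 0) (e (Suc 0)))"
    unfolding out_def
    by (rule Rec_list_encode)
       (intro Rec_decoded_code Rec_grid Rec_mult Rec_const stage Rec_prod_decode_snd Rec_comp1[OF I stage] Rec_var; simp)
  ultimately obtain p where p: "\<And>os e. length os = 2 \<Longrightarrow>
      (\<exists>w. settled ?d R u v c0 S (stage (e 0) w) (L os (stage (e 0) w)) (I os (stage (e 0) w)) (snd (prod_decode w)) (e 0)) \<Longrightarrow>
      (\<exists>w. settled ?d R u v c0 S (stage (e 0) w) (L os (stage (e 0) w)) (I os (stage (e 0) w)) (snd (prod_decode w)) (e 0) \<and>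
         reval os p (map e [0..<1]) (out os w (e 0)))"
    using Rec_search[of 1 "\<lambda>os w e. settled ?d R u v c0 S (stage (e 0) w) (L os (stage (e 0) w)) (I os (stage (e 0) w)) (snd (prod_decode w)) (e 0)"
        "\<lambda>os w e. out os w (e 0)"] by blast
  show ?thesis
    unfolding computable_fun_with_oracle_def
  proof (rule exI[of _ p], intro ballI allI impI)
    fix t Ot g h r
    assume t: "t \<in> {0..1}" and Ot: "is_oracle Ot t" and g: "codes_oracle g Ot" and h: "codes_oracle h Ol"
    let ?os = "[g, h]"
    have Lb: "l * 4 ^ n \<le> real (L ?os n)" "real (L ?os n) \<le> l * 4 ^ n + 4" for n
    proof -
      let ?q = "real_of_rat (rat_of_code (h (2 * n)))"
      have "\<bar>?q - l\<bar> \<le> 1 / 4 ^ n"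
        using assms(6) h unfolding is_oracle_def codes_oracle_def two_powr_minus four by simp
      then have "\<bar>max 0 ?q - l\<bar> \<le> 1 / 4 ^ n" using lp by linarith
      then have "\<bar>max 0 ?q - l\<bar> * 4 ^ n \<le> 1 / 4 ^ n * 4 ^ n" by (intro mult_right_mono) auto
      then have "\<bar>max 0 ?q * 4 ^ n - l * 4 ^ n\<bar> \<le> 1" by (simp add: abs_mult flip: left_diff_distrib)
      moreover have "\<bar>real (scaled_code 0 (2 * n) (h (2 * n))) - max 0 ?q * 4 ^ n\<bar> \<le> 1"
        using scaled_code[of 0 "2 * n" "h (2 * n)"] by (simp add: four)
      moreover have "real (L ?os n) = real (scaled_code 0 (2 * n) (h (2 * n))) + 2" by (simp add: L_def)
      ultimately show "l * 4 ^ n \<le> real (L ?os n)" "real (L ?os n) \<le> l * 4 ^ n + 4" by linarith+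
    qed
    have IN: "I ?os n \<le> 2 ^ n" for n by (simp add: I_def)
    have It: "\<bar>real (I ?os n) / 2 ^ n - t\<bar> \<le> 2 / 2 ^ n" for n
    proof -
      let ?q = "real_of_rat (rat_of_code (g n))"
      have "\<bar>?q - t\<bar> \<le> 1 / 2 ^ n" using Ot g unfolding is_oracle_def codes_oracle_def two_powr_minus by simp
      then have "\<bar>max 0 ?q - t\<bar> \<le> 1 / 2 ^ n" using t by auto
      then have "\<bar>max 0 ?q - t\<bar> * 2 ^ n \<le> 1 / 2 ^ n * 2 ^ n" by (intro mult_right_mono) auto
      then have "\<bar>max 0 ?q * 2 ^ n - t * 2 ^ n\<bar> \<le> 1" by (simp add: abs_mult flip: left_diff_distrib)
      moreover have "\<bar>real (scaled_code 0 n (g n)) - max 0 ?q * 2 ^ n\<bar> \<le> 1"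
        using scaled_code[of 0 n "g n"] by simp
      moreover have "t * 2 ^ n \<le> 2 ^ n" using t mult_right_mono[of t 1 "2 ^ n"] by simp
      moreover have "real (I ?os n) = min (2 ^ n) (real (scaled_code 0 n (g n)))" by (simp add: I_def of_nat_min)
      ultimately have "\<bar>real (I ?os n) - t * 2 ^ n\<bar> \<le> 2" by linarith
      then have "\<bar>real (I ?os n) - t * 2 ^ n\<bar> / 2 ^ n \<le> 2 / 2 ^ n" by (intro divide_right_mono) auto
      moreover have "\<bar>real (I ?os n) - t * 2 ^ n\<bar> / 2 ^ n = \<bar>(real (I ?os n) - t * 2 ^ n) / 2 ^ n\<bar>" by simp
      moreover have "(real (I ?os n) - t * 2 ^ n) / 2 ^ n = real (I ?os n) / 2 ^ n - t" by (simp add: diff_divide_distrib)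
      ultimately show ?thesis by simp
    qed
    obtain m Q where mQ: "\<And>i. i \<le> 2 ^ (r + K + m) \<Longrightarrow> settled ?d R u v c0 S (r + K + m) (L ?os (r + K + m)) i Q r"
      using ex_settled[OF ctx Lb, of "r + K" r] by blast
    have "\<exists>w. settled ?d R u v c0 S (stage r w) (L ?os (stage r w)) (I ?os (stage r w)) (snd (prod_decode w)) r"
      by (rule exI[of _ "prod_encode (m, Q)"]) (use mQ[OF IN] in \<open>simp add: stage_def\<close>)
    from p[of ?os "\<lambda>_. r", OF _ this]
    obtain w where w: "settled ?d R u v c0 S (stage r w) (L ?os (stage r w)) (I ?os (stage r w)) (snd (prod_decode w)) r"
      and rev: "reval ?os p (map (\<lambda>_. r) [0..<1]) (out ?os w r)"
      by (simp del: upt_Suc) blast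
    define n where "n = stage r w"
    define i where "i = I ?os n"
    define x :: "real ^ 'n" where "x = point_of_code (out ?os w r)"
    have i: "i \<le> 2 ^ n" unfolding i_def by (rule IN)
    have "real i \<le> real (2 ^ n)" using i by (simp only: of_nat_le_iff)
    then have "i / 2 ^ n \<in> {0..1}" by simp
    from lipschitz_onD[OF param_lipschitz[OF par] this t]
    have "dist (\<gamma> (i / 2 ^ n)) (\<gamma> t) \<le> l * \<bar>i / 2 ^ n - t\<bar>" by (simp add: dist_real_def)
    also have "\<dots> \<le> l * (2 / 2 ^ n)" unfolding i_def using It[of n] lp by (intro mult_left_mono) auto
    finally have \<gamma>t: "norm (\<gamma> (i / 2 ^ n) - \<gamma> t) \<le> 2 * l / 2 ^ n" by (simp add: dist_norm mult.commute)
    have n: "1 / 2 ^ n + 2 * l / 2 ^ n \<le> 1 / (2 ^ r * (4 * ?d))"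
    proof -
      have "(1 + 2 * l) * (2 ^ r * (4 * ?d)) \<le> 2 ^ r * 2 ^ K"
        using mult_left_mono[OF K, of "2 ^ r"] by (simp add: mult_ac)
      also have "\<dots> \<le> (2::real) ^ n" unfolding n_def stage_def by (simp add: power_add)
      finally have "(1 + 2 * l) / 2 ^ n \<le> 1 / (2 ^ r * (4 * ?d))" by (simp add: field_simps)
      then show ?thesis by (simp add: add_divide_distrib)
    qed
    have "\<bar>(x - \<gamma> t) $ (coord_enum ! c)\<bar> \<le> 1 / (2 ^ r * ?d)" if c: "c < ?d" for c
    proof -
      have "code_nth (out ?os w r) c = decoded_code R (2 * n) (grid ?d R n (snd (prod_decode w)) i c)"
        using c by (simp add: out_def code_nth n_def i_def)
      then have "x $ (coord_enum ! c) = real (grid ?d R n (snd (prod_decode w)) i c) / 4 ^ n - R"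
        unfolding x_def point_of_code_nth[OF c] by (simp add: decoded_code four)
      then have "\<bar>(x - \<gamma> (i / 2 ^ n)) $ (coord_enum ! c)\<bar> \<le> 1 / (2 ^ r * (4 * ?d)) + 1 / 4 ^ n"
        using settled_sound[OF ctx w Lb(1) IN c] by (simp add: n_def i_def)
      moreover have "\<bar>(\<gamma> (i / 2 ^ n) - \<gamma> t) $ (coord_enum ! c)\<bar> \<le> 2 * l / 2 ^ n"
        by (rule order_trans[OF component_le_norm_cart \<gamma>t])
      moreover have "1 / 4 ^ n \<le> 1 / (2::real) ^ n" by (intro divide_left_mono power_mono) auto
      \<comment> \<open>One share is the tolerance in \<open>settled\<close>; the grid rounding and
        the time error together take at most another by the choice of \<open>K\<close>.\<close>
      ultimately have "\<bar>x $ (coord_enum ! c) - \<gamma> t $ (coord_enum ! c)\<bar> \<le> 2 * (1 / (2 ^ r * (4 * ?d)))"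
        using n unfolding vector_minus_component by linarith
      also have "\<dots> \<le> 1 / (2 ^ r * ?d)" by (simp add: field_simps)
      finally show ?thesis by simp
    qed
    then have "norm (x - \<gamma> t) \<le> ?d * (1 / (2 ^ r * ?d))" by (rule norm_vec_le_coord)
    then have "dist x (\<gamma> t) \<le> 2 powr (- real r)" by (simp add: dist_norm two_powr_minus)
    then show "\<exists>c. reval ?os p [r] c \<and> dist (point_of_code c :: real ^ 'n) (\<gamma> t) \<le> 2 powr (- real r)"
      using rev unfolding x_def by auto
  qed
qed

end
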